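(* Let $\mathcal U\subseteq\mathcal T_n$ be an admissible tree set and assume the local metric expansion for the output metric $d$ and the coefficient norm $\|\cdot\|$. Let $\rho:T\to T'$ be an elementary rotation edge with $T,T'\in\mathcal U$, and let $K_\rho=B_{T'}-B_T$. If $K_\rho\neq0$, then \[ \liminf_{\varepsilon\downarrow0}\varepsilon^{-2}\operatorname{AOD}_{f,\mathbf w}^{\mathcal U}(p_1^\varepsilon,\dots,p_n^\varepsilon)\ge\|K_\rho\|. \] For a root rotation from $(AB)C$ to $A(BC)$, $K_\rho=-\mathcal C(A,B,C)$; for the reverse orientation, $K_\rho=\mathcal C(A,B,C)$. In either case, the lower bound is $\|\mathcal C(A,B,C)\|$.
   Context: $(\Omega,\mathcal F,\mu)$ is a measure space and $p$ a strictly positive probability density with respect to $\mu$. For measurable $q$ with $q/p\in L^\infty(\mu)$, $\|q\|_{p,\infty}=\|q/p\|_\infty$. The real parameter $\varepsilon\ne0$ tends to $0$. Generator: $f:(0,\infty)\to\mathbb R$ is convex and $C^3$ in a neighborhood of $1$, with $f(1)=f'(1)=0$, $f''(1)>0$; $A_2=f''(1)/2$, $A_3=f'''(1)/6$; $D_f(r\|q)=\int_\Omega q f(r/q)\,d\mu$. Coefficient $\tau$: for $a,b>0$ and bounded measurable $u,v$ with $\Delta=v-u$, $J=\int\Delta^2p\,d\mu>0$, $L_3=\int\Delta^3p\,d\mu$, $t_0=\frac{\sqrt b}{\sqrt a+\sqrt b}$, \[ \tau(a,b;u,v)=\frac{A_3L_3\{at_0^3+b(1-t_0)^3\}}{2A_2J\{at_0+b(1-t_0)\}}.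 \] Trees: $\mathcal T_n$ ($n\ge2$ fixed) is the set of full ordered binary trees with $n$ leaves, labelled $1,\dots,n$ from left to right; the block of a node is the set of (consecutive) leaves below it, and an internal node merges the adjacent blocks $A$ (left child) and $B$ (right child) into $AB$. Leaves: $\mathbf w=(w_1,\dots,w_n)\in(0,\infty)^n$, $G_i=\sqrt{w_i}$, and the leaf inputs are probability densities $p_i^\varepsilon=p+\varepsilon h_i+\varepsilon^2B_i+o(\varepsilon^2)$ (remainder in $\|\cdot\|_{p,\infty}$) with $\int h_i\,d\mu=\int B_i\,d\mu=0$ and $h_i/p,B_i/p$ bounded. Recursion: for a block, $G_A=\sum_{i\in A}G_i$. At leaves $H_i=h_i$ and the second-order coefficient is $B_i$. When a node merges $A$ and $B$, with $\theta_{AB}=\frac{G_B}{G_A+G_B}$, \[ H_{AB}=\frac{G_AH_A+G_BH_B}{G_A+G_B},\qquad B_{AB}=(1-\theta_{AB})B_A+\theta_{AB}B_B+\tau(G_A^2,G_B^2;H_A/p,H_B/p)(H_B-H_A). \] $B_T$ is the resulting coefficient at the root of $T$. Admissibility: a nonempty $\mathcal U\subseteq\mathcal T_n$ is an admissible tree set if, for all trees in $\mathcal U$, all coefficients $H_A,B_A$ generated by the recursion have $H_A/p,B_A/p\in L^\infty(\mu)$ and every generated merge is nondegenerate: $J(A,B)=\int_\Omega\left(\frac{H_B-H_A}{p}\right)^2p\,d\mu>0$. Mass-carrying protocol: for $T\in\mathcal U$, leaf $i$ has state $(G_i,p_i^\varepsilon)$. At a merge of $A$ and $B$, $G_{AB}=G_A+G_B$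 and $q_{AB}^\varepsilon=(1-t_{AB}^\varepsilon)q_A^\varepsilon+t_{AB}^\varepsilon q_B^\varepsilon$, where $t_{AB}^\varepsilon\in[0,1]$ is the local solution of $G_A^2D_f(q_A^\varepsilon\|q_{AB}^\varepsilon)=G_B^2D_f(q_B^\varepsilon\|q_{AB}^\varepsilon)$ converging to $\frac{G_B}{G_A+G_B}$ as $\varepsilon\to0$ (for small $\varepsilon\neq 0$, the unique solution in a fixed small neighborhood of that value). The root density is $F_{T,\mathbf w}^\varepsilon$. Diameter: $\operatorname{AOD}_{f,\mathbf w}^{\mathcal U}(p_1^\varepsilon,\dots,p_n^\varepsilon)=\sup_{T,T'\in\mathcal U}d(F_{T,\mathbf w}^\varepsilon,F_{T',\mathbf w}^\varepsilon)$, where $d$ is the output metric on densities. Local metric expansion: $\|\cdot\|$ is a norm on zero-mass second-order coefficients (functions $g$ with $\int g\,d\mu=0$ and $g/p\in L^\infty(\mu)$), and for a common first-order coefficient $H_0$ and zero-mass second-order coefficients $U,V$ in the generated local chart, \[ d\bigl(p+\varepsilon H_0+\varepsilon^2U+o(\varepsilon^2),\,p+\varepsilon H_0+\varepsilon^2V+o(\varepsilon^2)\bigr)=\varepsilon^2\|U-V\|+o(\varepsilon^2) \] uniformly over that chart, the density remainders being $o(\varepsilon^2)$ in $\|\cdot\|_{p,\infty}$. Rotations: an elementary rotation replaces a subtree of the form $(AB)C$ by $A(BC)$, or conversely, with $A,B,C$ adjacent blocks with fixed subtrees, leaving the rest of the tree unchanged; it is a root rotation if this subtree is the whole tree. $\mathcal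 C(A,B,C)=B^{(AB)C}-B^{A(BC)}$, where $B^{(AB)C}$ and $B^{A(BC)}$ are the second-order coefficients produced by the recursion at block $ABC$ by the two bracketings. *)

theory Defs
  imports "HOL-Probability.Essential_Supremum"
begin

section \<open>Densities, weighted norm, divergence\<close>

definition prob_density :: "'a measure \<Rightarrow> ('a \<Rightarrow> real) \<Rightarrow> bool" where
  "prob_density M q \<longleftrightarrow>
     q \<in> borel_measurable M \<and> (\<forall>x\<in>space M. 0 \<le> q x) \<and> integrable M q \<and> (\<integral>x. q x \<partial>M) = 1"

definition pnorm :: "'a measure \<Rightarrow> ('a \<Rightarrow> real) \<Rightarrow> ('a \<Rightarrow> real) \<Rightarrow> ereal" where
  "pnorm M p q = esssup M (\<lambda>x. ereal \<bar>q x / p x\<bar>)"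

definition bounded_coeffs :: "'a measure \<Rightarrow> ('a \<Rightarrow> real) \<Rightarrow> ('a \<Rightarrow> real) set" where
  "bounded_coeffs M p = {g \<in> borel_measurable M. pnorm M p g < \<infinity>}"

definition zero_mass_coeffs :: "'a measure \<Rightarrow> ('a \<Rightarrow> real) \<Rightarrow> ('a \<Rightarrow> real) set" where
  "zero_mass_coeffs M p = {g \<in> bounded_coeffs M p. (\<integral>x. g x \<partial>M) = 0}"

text \<open>A generator is a function on the positive reals; its values on the nonpositive reals are
  arbitrary and never enter for the ratios close to \<open>1\<close> that occur for small \<open>\<epsilon>\<close>.\<close>

definition generator :: "(real \<Rightarrow> real) \<Rightarrow> bool" where
  "generator f \<longleftrightarrow>
     convex_on {0<..} f \<and>
     (\<exists>\<delta>>0. (\<forall>k<3. \<forall>y\<in>ball 1 \<delta>. (deriv ^^ k) f field_differentiable (at y)) \<and>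
            continuous_on (ball 1 \<delta>) ((deriv ^^ 3) f)) \<and>
     f 1 = 0 \<and> deriv f 1 = 0 \<and> (deriv ^^ 2) f 1 > 0"

definition A2 :: "(real \<Rightarrow> real) \<Rightarrow> real" where
  "A2 f = (deriv ^^ 2) f 1 / 2"

definition A3 :: "(real \<Rightarrow> real) \<Rightarrow> real" where
  "A3 f = (deriv ^^ 3) f 1 / 6"

definition fdiv :: "'a measure \<Rightarrow> (real \<Rightarrow> real) \<Rightarrow> ('a \<Rightarrow> real) \<Rightarrow> ('a \<Rightarrow> real) \<Rightarrow> real" where
  "fdiv M f r q = (\<integral>x. q x * f (r x / q x) \<partial>M)"

definition tau :: "'a measure \<Rightarrow> ('a \<Rightarrow> real) \<Rightarrow> (real \<Rightarrow> real) \<Rightarrow> real \<Rightarrow> real \<Rightarrow>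
    ('a \<Rightarrow> real) \<Rightarrow> ('a \<Rightarrow> real) \<Rightarrow> real" where
  "tau M p f a b u v =
    (let J = (\<integral>x. (v x - u x)^2 * p x \<partial>M);
         L3 = (\<integral>x. (v x - u x)^3 * p x \<partial>M);
         t0 = sqrt b / (sqrt a + sqrt b)
     in (A3 f * L3 * (a * t0^3 + b * (1 - t0)^3)) / (2 * A2 f * J * (a * t0 + b * (1 - t0))))"

section \<open>Full ordered binary trees and rotations\<close>

datatype btree = Lf nat | Merge btree btree

primrec leaves :: "btree \<Rightarrow> nat list" where
  "leaves (Lf i) = [i]"
| "leaves (Merge l r) = leaves l @ leaves r"

definition full_trees :: "nat \<Rightarrow> btree set" where
  "full_trees n = {T. leaves T = [1..<n+1]}"

abbreviation block :: "btree \<Rightarrow> nat set" where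
  "block T \<equiv> set (leaves T)"

primrec subtrees :: "btree \<Rightarrow> btree set" where
  "subtrees (Lf i) = {Lf i}"
| "subtrees (Merge l r) = insert (Merge l r) (subtrees l \<union> subtrees r)"

inductive elem_rotation :: "btree \<Rightarrow> btree \<Rightarrow> bool" where
  rot_right: "elem_rotation (Merge (Merge A B) C) (Merge A (Merge B C))"
| rot_left: "elem_rotation (Merge A (Merge B C)) (Merge (Merge A B) C)"
| in_left: "elem_rotation T T' \<Longrightarrow> elem_rotation (Merge T S) (Merge T' S)"
| in_right: "elem_rotation T T' \<Longrightarrow> elem_rotation (Merge S T) (Merge S T')"

section \<open>Recursion for the coefficients\<close>

definition G :: "(nat \<Rightarrow> real) \<Rightarrow> btree \<Rightarrow> real" where
  "G w T = (\<Sum>i\<in>block T. sqrt (w i))"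

definition theta :: "(nat \<Rightarrow> real) \<Rightarrow> btree \<Rightarrow> btree \<Rightarrow> real" where
  "theta w l r = G w r / (G w l + G w r)"

primrec coefH :: "(nat \<Rightarrow> real) \<Rightarrow> (nat \<Rightarrow> 'a \<Rightarrow> real) \<Rightarrow> btree \<Rightarrow> 'a \<Rightarrow> real" where
  "coefH w h (Lf i) = h i"
| "coefH w h (Merge l r) =
     (\<lambda>x. (G w l * coefH w h l x + G w r * coefH w h r x) / (G w l + G w r))"

primrec coefB :: "'a measure \<Rightarrow> ('a \<Rightarrow> real) \<Rightarrow> (real \<Rightarrow> real) \<Rightarrow> (nat \<Rightarrow> real) \<Rightarrow>
    (nat \<Rightarrow> 'a \<Rightarrow> real) \<Rightarrow> (nat \<Rightarrow> 'a \<Rightarrow> real) \<Rightarrow> btree \<Rightarrow> 'a \<Rightarrow> real" where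
  "coefB M p f w h b (Lf i) = b i"
| "coefB M p f w h b (Merge l r) =
     (\<lambda>x. (1 - theta w l r) * coefB M p f w h b l x + theta w l r * coefB M p f w h b r x
        + tau M p f ((G w l)^2) ((G w r)^2)
            (\<lambda>y. coefH w h l y / p y) (\<lambda>y. coefH w h r y / p y)
          * (coefH w h r x - coefH w h l x))"

definition mergeJ :: "'a measure \<Rightarrow> ('a \<Rightarrow> real) \<Rightarrow> (nat \<Rightarrow> real) \<Rightarrow> (nat \<Rightarrow> 'a \<Rightarrow> real) \<Rightarrow>
    btree \<Rightarrow> btree \<Rightarrow> real" where
  "mergeJ M p w h l r = (\<integral>x. ((coefH w h r x - coefH w h l x) / p x)^2 * p x \<partial>M)"

definition admissible :: "'a measure \<Rightarrow> ('a \<Rightarrow> real) \<Rightarrow> (real \<Rightarrow> real) \<Rightarrow> (nat \<Rightarrow> real) \<Rightarrow>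
    (nat \<Rightarrow> 'a \<Rightarrow> real) \<Rightarrow> (nat \<Rightarrow> 'a \<Rightarrow> real) \<Rightarrow> nat \<Rightarrow> btree set \<Rightarrow> bool" where
  "admissible M p f w h b n \<U> \<longleftrightarrow>
     \<U> \<noteq> {} \<and> \<U> \<subseteq> full_trees n \<and>
     (\<forall>T\<in>\<U>. \<forall>S\<in>subtrees T.
        coefH w h S \<in> bounded_coeffs M p \<and> coefB M p f w h b S \<in> bounded_coeffs M p) \<and>
     (\<forall>T\<in>\<U>. \<forall>l r. Merge l r \<in> subtrees T \<longrightarrow> mergeJ M p w h l r > 0)"

definition rotation_defect :: "'a measure \<Rightarrow> ('a \<Rightarrow> real) \<Rightarrow> (real \<Rightarrow> real) \<Rightarrow> (nat \<Rightarrow> real) \<Rightarrow>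
    (nat \<Rightarrow> 'a \<Rightarrow> real) \<Rightarrow> (nat \<Rightarrow> 'a \<Rightarrow> real) \<Rightarrow> btree \<Rightarrow> btree \<Rightarrow> 'a \<Rightarrow> real" where
  "rotation_defect M p f w h b T T' = (\<lambda>x. coefB M p f w h b T' x - coefB M p f w h b T x)"

definition curvature :: "'a measure \<Rightarrow> ('a \<Rightarrow> real) \<Rightarrow> (real \<Rightarrow> real) \<Rightarrow> (nat \<Rightarrow> real) \<Rightarrow>
    (nat \<Rightarrow> 'a \<Rightarrow> real) \<Rightarrow> (nat \<Rightarrow> 'a \<Rightarrow> real) \<Rightarrow> btree \<Rightarrow> btree \<Rightarrow> btree \<Rightarrow> 'a \<Rightarrow> real" where
  "curvature M p f w h b A B C =
     (\<lambda>x. coefB M p f w h b (Merge (Merge A B) C) x - coefB M p f w h b (Merge A (Merge B C)) x)"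

section \<open>Second-order expansions of families of densities\<close>

text \<open>A family \<open>q\<close> indexed by pairs \<open>(H, U)\<close> in \<open>\<C>\<close> consists of probability densities for small
  \<open>\<epsilon> \<noteq> 0\<close> and satisfies \<open>q H U \<epsilon> = p + \<epsilon> H + \<epsilon>\<^sup>2 U + o(\<epsilon>\<^sup>2)\<close> in the weighted norm, uniformly
  over \<open>\<C>\<close>.\<close>

definition density_expansion :: "'a measure \<Rightarrow> ('a \<Rightarrow> real) \<Rightarrow> (('a \<Rightarrow> real) \<times> ('a \<Rightarrow> real)) set \<Rightarrow>
    (('a \<Rightarrow> real) \<Rightarrow> ('a \<Rightarrow> real) \<Rightarrow> real \<Rightarrow> 'a \<Rightarrow> real) \<Rightarrow> bool" where
  "density_expansion M p \<C> q \<longleftrightarrow>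
     (\<forall>\<^sub>F \<epsilon> in at 0. \<forall>(H, U)\<in>\<C>. prob_density M (q H U \<epsilon>)) \<and>
     (\<forall>c>0. \<forall>\<^sub>F \<epsilon> in at 0. \<forall>(H, U)\<in>\<C>.
        pnorm M p (\<lambda>x. q H U \<epsilon> x - (p x + \<epsilon> * H x + \<epsilon>^2 * U x)) \<le> ereal (c * \<epsilon>^2))"

section \<open>Mass-carrying protocol\<close>

definition balanced :: "'a measure \<Rightarrow> (real \<Rightarrow> real) \<Rightarrow> real \<Rightarrow> real \<Rightarrow>
    ('a \<Rightarrow> real) \<Rightarrow> ('a \<Rightarrow> real) \<Rightarrow> real \<Rightarrow> bool" where
  "balanced M f gA gB qA qB s \<longleftrightarrow>
     gA^2 * fdiv M f qA (\<lambda>x. (1 - s) * qA x + s * qB x) =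
     gB^2 * fdiv M f qB (\<lambda>x. (1 - s) * qA x + s * qB x)"

text \<open>\<open>t\<close> is the branch of solutions in \<open>[0,1]\<close> that converges to \<open>\<theta>\<close>: for small \<open>\<epsilon> \<noteq> 0\<close> it is the
  only solution in a fixed neighbourhood of \<open>\<theta>\<close>.\<close>

definition local_solution :: "'a measure \<Rightarrow> (real \<Rightarrow> real) \<Rightarrow> real \<Rightarrow> real \<Rightarrow>
    (real \<Rightarrow> 'a \<Rightarrow> real) \<Rightarrow> (real \<Rightarrow> 'a \<Rightarrow> real) \<Rightarrow> real \<Rightarrow> (real \<Rightarrow> real) \<Rightarrow> bool" where
  "local_solution M f gA gB qA qB \<theta> t \<longleftrightarrow>
     (t \<longlongrightarrow> \<theta>) (at 0) \<and>
     (\<exists>\<delta>>0. \<forall>\<^sub>F \<epsilon> in at 0.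
        t \<epsilon> \<in> {0..1} \<and> balanced M f gA gB (qA \<epsilon>) (qB \<epsilon>) (t \<epsilon>) \<and>
        (\<forall>s\<in>{0..1}. \<bar>s - \<theta>\<bar> < \<delta> \<and> balanced M f gA gB (qA \<epsilon>) (qB \<epsilon>) s \<longrightarrow> s = t \<epsilon>))"

text \<open>The density carried by a node, given the leaf densities \<open>pe\<close> and the mixing weight
  \<open>t S \<epsilon>\<close> used at each internal node, named by the subtree \<open>S\<close> below it.\<close>

primrec node_density :: "(nat \<Rightarrow> real \<Rightarrow> 'a \<Rightarrow> real) \<Rightarrow> (btree \<Rightarrow> real \<Rightarrow> real) \<Rightarrow>
    btree \<Rightarrow> real \<Rightarrow> 'a \<Rightarrow> real" where
  "node_density pe t (Lf i) = pe i"
| "node_density pe t (Merge l r) =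
     (\<lambda>\<epsilon> x. (1 - t (Merge l r) \<epsilon>) * node_density pe t l \<epsilon> x
           + t (Merge l r) \<epsilon> * node_density pe t r \<epsilon> x)"

definition mass_protocol :: "'a measure \<Rightarrow> (real \<Rightarrow> real) \<Rightarrow> (nat \<Rightarrow> real) \<Rightarrow>
    (nat \<Rightarrow> real \<Rightarrow> 'a \<Rightarrow> real) \<Rightarrow> btree set \<Rightarrow> (btree \<Rightarrow> real \<Rightarrow> real) \<Rightarrow> bool" where
  "mass_protocol M f w pe \<U> t \<longleftrightarrow>
     (\<forall>T\<in>\<U>. \<forall>l r. Merge l r \<in> subtrees T \<longrightarrow>
        local_solution M f (G w l) (G w r) (node_density pe t l) (node_density pe t r)
          (theta w l r) (t (Merge l r)))"

text \<open>The supremum is taken in the extended reals, so that it needs no boundedness side condition.\<close>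

definition AOD :: "(('a \<Rightarrow> real) \<Rightarrow> ('a \<Rightarrow> real) \<Rightarrow> real) \<Rightarrow> (nat \<Rightarrow> real \<Rightarrow> 'a \<Rightarrow> real) \<Rightarrow>
    (btree \<Rightarrow> real \<Rightarrow> real) \<Rightarrow> btree set \<Rightarrow> real \<Rightarrow> ereal" where
  "AOD d pe t \<U> \<epsilon> =
     (SUP T\<in>\<U>. SUP T'\<in>\<U>. ereal (d (node_density pe t T \<epsilon>) (node_density pe t T' \<epsilon>)))"

section \<open>Output metric and coefficient norm\<close>

text \<open>Densities and coefficients are functions identified when they agree almost everywhere.\<close>

definition density_metric :: "'a measure \<Rightarrow> (('a \<Rightarrow> real) \<Rightarrow> ('a \<Rightarrow> real) \<Rightarrow> real) \<Rightarrow> bool" where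
  "density_metric M d \<longleftrightarrow>
     (\<forall>q r. prob_density M q \<longrightarrow> prob_density M r \<longrightarrow>
        0 \<le> d q r \<and> d q r = d r q \<and> (d q r = 0 \<longleftrightarrow> (AE x in M. q x = r x))) \<and>
     (\<forall>q r s. prob_density M q \<longrightarrow> prob_density M r \<longrightarrow> prob_density M s \<longrightarrow>
        d q s \<le> d q r + d r s)"

definition coeff_norm :: "'a measure \<Rightarrow> ('a \<Rightarrow> real) \<Rightarrow> (('a \<Rightarrow> real) \<Rightarrow> real) \<Rightarrow> bool" where
  "coeff_norm M p N \<longleftrightarrow>
     (\<forall>g\<in>zero_mass_coeffs M p. 0 \<le> N g \<and> (N g = 0 \<longleftrightarrow> (AE x in M. g x = 0)) \<and>
        (\<forall>c. N (\<lambda>x. c * g x) = \<bar>c\<bar> * N g)) \<and>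
     (\<forall>g\<in>zero_mass_coeffs M p. \<forall>k\<in>zero_mass_coeffs M p. N (\<lambda>x. g x + k x) \<le> N g + N k)"

definition local_metric_expansion :: "'a measure \<Rightarrow> ('a \<Rightarrow> real) \<Rightarrow>
    (('a \<Rightarrow> real) \<Rightarrow> ('a \<Rightarrow> real) \<Rightarrow> real) \<Rightarrow> (('a \<Rightarrow> real) \<Rightarrow> real) \<Rightarrow>
    (('a \<Rightarrow> real) \<times> ('a \<Rightarrow> real)) set \<Rightarrow> bool" where
  "local_metric_expansion M p d N \<C> \<longleftrightarrow>
     (\<forall>q r. density_expansion M p \<C> q \<longrightarrow> density_expansion M p \<C> r \<longrightarrow>
        (\<forall>c>0. \<forall>\<^sub>F \<epsilon> in at 0. \<forall>H0 U V. (H0, U) \<in> \<C> \<longrightarrow> (H0, V) \<in> \<C> \<longrightarrow>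
           \<bar>d (q H0 U \<epsilon>) (r H0 V \<epsilon>) - \<epsilon>^2 * N (\<lambda>x. U x - V x)\<bar> \<le> c * \<epsilon>^2))"

text \<open>The local chart: first- and second-order coefficients generated at the roots.\<close>

definition generated_chart :: "'a measure \<Rightarrow> ('a \<Rightarrow> real) \<Rightarrow> (real \<Rightarrow> real) \<Rightarrow> (nat \<Rightarrow> real) \<Rightarrow>
    (nat \<Rightarrow> 'a \<Rightarrow> real) \<Rightarrow> (nat \<Rightarrow> 'a \<Rightarrow> real) \<Rightarrow> btree set \<Rightarrow>
    (('a \<Rightarrow> real) \<times> ('a \<Rightarrow> real)) set" where
  "generated_chart M p f w h b \<U> = (\<lambda>T. (coefH w h T, coefB M p f w h b T)) ` \<U>"

end

theory Submission
  imports Defs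
begin

text \<open>
  Every node density in the protocol has an expansion \<open>p + \<epsilon> H + \<epsilon>\<^sup>2 B + o(\<epsilon>\<^sup>2)\<close> with the coefficients
  of the recursion. At a merge with mixture \<open>Q\<close> and difference \<open>R = q\<^sub>B - q\<^sub>A\<close>, both inputs are of the form
  \<open>Q + \<kappa> R\<close> with \<open>\<kappa> = -t\<close> and \<open>\<kappa> = 1 - t\<close>, and Taylor's theorem gives
  \<open>D\<^sub>f(Q + \<kappa> R \<parallel> Q) = \<epsilon>\<^sup>2 (A\<^sub>2 \<kappa>\<^sup>2 I + \<epsilon> L)\<close> with one and the same \<open>I \<longlongrightarrow> J\<close> for both inputs and
  \<open>L \<longlongrightarrow> \<kappa>\<^sup>3 A\<^sub>3 L\<^sub>3\<close>. Since \<open>G\<^sub>A\<^sup>2 t\<^sup>2 - G\<^sub>B\<^sup>2 (1 - t)\<^sup>2\<close> has the factor \<open>t - \<theta>\<close>, the balance equation can be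
  solved for \<open>(t - \<theta>) / \<epsilon>\<close>, whose limit is \<open>\<tau>\<close>. The first-order coefficient at the root is the weighted mean
  of the \<open>h\<^sub>i\<close>, the same for all trees, so the metric expansion compares the two root densities of the
  rotation edge, and this pair bounds the diameter from below.
\<close>

section \<open>The generator near 1\<close>

text \<open>The Taylor terms of order 0 and 1 vanish because \<open>f 1 = 0\<close> and
  \<open>deriv f 1 = 0\<close>. The Lagrange remainder carries the third derivative at a point
  between 1 and \<open>1 + x\<close>, so its continuity at 1 gives the limit.\<close>

lemma generator_taylor:
  assumes "generator f"
  shows "((\<lambda>x. (f (1 + x) - A2 f * x\<^sup>2) / x ^ 3) \<longlongrightarrow> A3 f) (at 0)"
proof (rule tendstoI)
  fix c :: real assume c: "0 < c"
  from assms obtain \<delta> where \<delta>: "\<delta> > 0"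
    and df: "\<And>k y. k < 3 \<Longrightarrow> y \<in> ball 1 \<delta> \<Longrightarrow> (deriv ^^ k) f field_differentiable (at y)"
    and cont: "continuous_on (ball 1 \<delta>) ((deriv ^^ 3) f)"
    and f1: "f 1 = 0" "deriv f 1 = 0"
    unfolding generator_def by blast
  have "isCont ((deriv ^^ 3) f) 1"
    using cont \<delta> by (simp add: continuous_on_eq_continuous_at)
  then obtain \<eta> where \<eta>: "\<eta> > 0"
    and close: "\<And>y. \<bar>y - 1\<bar> < \<eta> \<Longrightarrow> \<bar>(deriv ^^ 3) f y - (deriv ^^ 3) f 1\<bar> < c"
    using c unfolding isCont_def LIM_def dist_real_def by (metis abs_zero cancel_comm_monoid_add_class.diff_cancel)
  have "dist ((f (1 + x) - A2 f * x\<^sup>2) / x ^ 3) (A3 f) < c"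
    if x: "x \<noteq> 0" "\<bar>x\<bar> < min \<delta> \<eta>" for x
  proof -
    have sub: "y \<in> ball 1 \<delta>" if "1 - \<bar>x\<bar> \<le> y" "y \<le> 1 + \<bar>x\<bar>" for y
      using that x by (auto simp: dist_real_def abs_if split: if_splits)
    \<comment> \<open>The interval from \<open>1 - \<bar>x\<bar>\<close> to
      \<open>1 + \<bar>x\<bar>\<close> treats both signs of \<open>x\<close> at once.\<close>
    have "\<exists>y. (if 1 + x < 1 then 1 + x < y \<and> y < 1 else 1 < y \<and> y < 1 + x) \<and>
        f (1 + x) = (\<Sum>m<3. ((deriv ^^ m) f) 1 / fact m * (1 + x - 1) ^ m)
          + ((deriv ^^ 3) f) y / fact 3 * (1 + x - 1) ^ 3"
      using x
      by (intro Taylor[where a = "1 - \<bar>x\<bar>" and b = "1 + \<bar>x\<bar>" and diff = "\<lambda>m. (deriv ^^ m) f"])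
        (auto intro!: DERIV_deriv_iff_field_differentiable[THEN iffD2] df sub simp: dist_real_def)
    then obtain y where "if x < 0 then 1 + x < y \<and> y < 1 else 1 < y \<and> y < 1 + x"
      and "f (1 + x) = (\<Sum>m<3. (deriv ^^ m) f 1 / fact m * x ^ m) + (deriv ^^ 3) f y / fact 3 * x ^ 3"
      by (auto simp only: add_diff_cancel_left' add_less_same_cancel1)
    then have y: "\<bar>y - 1\<bar> < \<bar>x\<bar>"
      and eq: "f (1 + x) = (deriv ^^ 2) f 1 / 2 * x\<^sup>2 + (deriv ^^ 3) f y / 6 * x ^ 3"
      using f1 by (auto simp: numeral_3_eq_3 numeral_2_eq_2 fact_numeral split: if_splits)
    have "(f (1 + x) - A2 f * x\<^sup>2) / x ^ 3 = (deriv ^^ 3) f y / 6"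
      using x(1) by (simp add: eq A2_def)
    moreover have "\<bar>(deriv ^^ 3) f y - (deriv ^^ 3) f 1\<bar> < c"
      using close[of y] y x by simp
    ultimately show ?thesis
      by (simp only: A3_def dist_real_def)
  qed
  then show "\<forall>\<^sub>F x in at 0. dist ((f (1 + x) - A2 f * x\<^sup>2) / x ^ 3) (A3 f) < c"
    unfolding eventually_at using \<delta> \<eta> by (intro exI[of _ "min \<delta> \<eta>"]) (auto simp: dist_real_def)
qed

text \<open>Nothing is assumed about \<open>f\<close> on the negative reals;
  on the nonnegative reals it can be discontinuous only at \<open>0\<close>.\<close>

lemma generator_comp_measurable:
  assumes "generator f" and r: "r \<in> borel_measurable M" and nn: "\<And>x. x \<in> space M \<Longrightarrow> 0 \<le> r x"
  shows "(\<lambda>x. f (r x)) \<in> borel_measurable M"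
proof -
  have "continuous_on {0<..} f"
    using assms(1) by (auto simp: generator_def intro: convex_on_continuous)
  \<comment> \<open>The constant \<open>f 0\<close> outside the open half-line gives a Borel
    function that agrees with \<open>f\<close> at every nonnegative value, hence at all values of
    \<open>r\<close>.\<close>
  then have "(\<lambda>y. if y \<in> {0<..} then f y else f 0) \<in> borel_measurable borel"
    by (intro borel_measurable_continuous_on_if) auto
  from measurable_compose[OF r this] show ?thesis
    by (rule measurable_cong[THEN iffD1, rotated]) (use nn in \<open>force simp: order.order_iff_strict\<close>)
qed

section \<open>Essentially uniform convergence and integrals\<close>

text \<open>Convergence along \<open>ae_uniform F M\<close> is convergence in \<open>L\<^sup>\<infinity>(M)\<close>, so that the limit laws for filters
  apply to it.\<close>

definition ae_uniform :: "'b filter \<Rightarrow> 'a measure \<Rightarrow> ('b \<times> 'a) filter" where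
  "ae_uniform F M = Abs_filter (\<lambda>P. \<forall>\<^sub>F e in F. AE x in M. P (e, x))"

lemma eventually_ae_uniform:
  "eventually P (ae_uniform F M) \<longleftrightarrow> (\<forall>\<^sub>F e in F. AE x in M. P (e, x))"
  unfolding ae_uniform_def
proof (rule eventually_Abs_filter, rule is_filter.intro)
  fix P Q :: "'a \<times> 'b \<Rightarrow> bool"
  assume "\<forall>\<^sub>F e in F. AE x in M. P (e, x)" "\<forall>\<^sub>F e in F. AE x in M. Q (e, x)"
  then show "\<forall>\<^sub>F e in F. AE x in M. P (e, x) \<and> Q (e, x)"
    by eventually_elim auto
next
  fix P Q :: "'a \<times> 'b \<Rightarrow> bool"
  assume "\<forall>z. P z \<longrightarrow> Q z" "\<forall>\<^sub>F e in F. AE x in M. P (e, x)"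
  then show "\<forall>\<^sub>F e in F. AE x in M. Q (e, x)"
    by (auto elim!: eventually_mono)
qed simp

lemma eventually_ae_uniform_fst:
  "eventually P F \<Longrightarrow> \<forall>\<^sub>F z in ae_uniform F M. P (fst z)"
  by (auto simp: eventually_ae_uniform elim: eventually_mono)

lemma eventually_ae_uniform_snd:
  "AE x in M. P x \<Longrightarrow> \<forall>\<^sub>F z in ae_uniform F M. P (snd z)"
  by (auto simp: eventually_ae_uniform)

lemma tendsto_ae_uniform_fst:
  assumes "(k \<longlongrightarrow> l) F" shows "((\<lambda>z. k (fst z)) \<longlongrightarrow> l) (ae_uniform F M)"
  using assms by (auto simp: tendsto_def eventually_ae_uniform_fst[where P = "\<lambda>e. k e \<in> S" for S])

text \<open>The limit functions vary with the point, so convergence is stated through differences.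
  The product rule follows by expanding \<open>f * f' - g * g'\<close> into the product of the two
  differences and two terms with one bounded factor each.\<close>

lemma tendsto_mult_bounded_diff:
  fixes f g f' g' :: "'b \<Rightarrow> real"
  assumes f: "((\<lambda>z. f z - g z) \<longlongrightarrow> 0) F" and f': "((\<lambda>z. f' z - g' z) \<longlongrightarrow> 0) F"
    and g: "\<forall>\<^sub>F z in F. \<bar>g z\<bar> \<le> K" and g': "\<forall>\<^sub>F z in F. \<bar>g' z\<bar> \<le> K'"
  shows "((\<lambda>z. f z * f' z - g z * g' z) \<longlongrightarrow> 0) F"
proof -
  have "((\<lambda>z. (f z - g z) * (f' z - g' z) + g z * (f' z - g' z) + (f z - g z) * g' z) \<longlongrightarrow> 0) F"
    using f f' g g'
    by (intro tendsto_add_zero tendsto_mult_zero lim_null_mult_left_bounded[where B = K]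
        lim_null_mult_right_bounded[where B = K']) auto
  then show ?thesis by (simp add: algebra_simps)
qed

text \<open>Since \<open>p\<close> has total mass 1, two integrals weighted by \<open>p\<close>
  differ by no more than the essential distance of the integrands.\<close>

lemma integral_ae_uniform:
  assumes p: "prob_density M p"
    and g: "\<forall>\<^sub>F e in F. g e \<in> borel_measurable M"
    and \<gamma>: "\<gamma> \<in> borel_measurable M" "AE x in M. \<bar>\<gamma> x\<bar> \<le> K"
    and lim: "((\<lambda>z. g (fst z) (snd z) - \<gamma> (snd z)) \<longlongrightarrow> 0) (ae_uniform F M)"
  shows "\<forall>\<^sub>F e in F. integrable M (\<lambda>x. p x * g e x)"
    and "((\<lambda>e. \<integral>x. p x * g e x \<partial>M) \<longlongrightarrow> (\<integral>x. p x * \<gamma> x \<partial>M)) F"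
proof -
  have pm: "p \<in> borel_measurable M" and pi: "integrable M p" and p1: "(\<integral>x. p x \<partial>M) = 1"
    and p0: "\<And>x. x \<in> space M \<Longrightarrow> 0 \<le> p x"
    using p by (auto simp: prob_density_def)
  have close: "\<forall>\<^sub>F e in F. AE x in M. \<bar>g e x - \<gamma> x\<bar> < c" if "c > 0" for c
    using tendstoD[OF lim that] by (simp add: eventually_ae_uniform dist_real_def)
  have int\<gamma>: "integrable M (\<lambda>x. p x * \<gamma> x)"
  proof (rule Bochner_Integration.integrable_bound)
    show "integrable M (\<lambda>x. p x * K)" using pi by simp
    show "AE x in M. norm (p x * \<gamma> x) \<le> norm (p x * K)"
      using \<gamma>(2) AE_space
      by eventually_elim (use p0 in \<open>auto simp: abs_mult intro!: mult_left_mono\<close>)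
  qed (use pm \<gamma> in simp)
  \<comment> \<open>An estimate at one fixed parameter. It is used with tolerance 1 for
    integrability and with \<open>c / 2\<close> for the limit, where halving makes the inequality
    strict.\<close>
  have key: "integrable M (\<lambda>x. p x * g e x) \<and>
      \<bar>(\<integral>x. p x * g e x \<partial>M) - (\<integral>x. p x * \<gamma> x \<partial>M)\<bar> \<le> c"
    if "c > 0" "g e \<in> borel_measurable M" and AEc: "AE x in M. \<bar>g e x - \<gamma> x\<bar> < c" for c e
  proof -
    have bd: "AE x in M. \<bar>p x * (g e x - \<gamma> x)\<bar> \<le> p x * c"
      using AEc AE_space
      by eventually_elim (use p0 in \<open>auto simp: abs_mult intro!: mult_left_mono\<close>)
    have i: "integrable M (\<lambda>x. p x * (g e x - \<gamma> x))"
      by (rule Bochner_Integration.integrable_bound[of _ "\<lambda>x. p x * c"])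
        (use pi pm \<gamma>(1) that(2) bd in \<open>auto elim!: eventually_mono intro: order_trans[OF _ abs_ge_self]\<close>)
    have "integrable M (\<lambda>x. p x * (g e x - \<gamma> x) + p x * \<gamma> x)"
      by (rule Bochner_Integration.integrable_add[OF i int\<gamma>])
    then have ig: "integrable M (\<lambda>x. p x * g e x)" by (simp add: algebra_simps)
    have "\<bar>\<integral>x. p x * (g e x - \<gamma> x) \<partial>M\<bar> \<le> (\<integral>x. \<bar>p x * (g e x - \<gamma> x)\<bar> \<partial>M)"
      using integral_norm_bound[of M "\<lambda>x. p x * (g e x - \<gamma> x)"] by simp
    also have "\<dots> \<le> (\<integral>x. p x * c \<partial>M)"
      by (rule integral_mono_AE) (use i pi bd in auto)
    also have "\<dots> = c" using p1 by simp
    finally show ?thesis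
      using ig int\<gamma> by (simp add: right_diff_distrib)
  qed
  show "\<forall>\<^sub>F e in F. integrable M (\<lambda>x. p x * g e x)"
    using g close[OF zero_less_one] by eventually_elim (use key[of 1] in auto)
  show "((\<lambda>e. \<integral>x. p x * g e x \<partial>M) \<longlongrightarrow> (\<integral>x. p x * \<gamma> x \<partial>M)) F"
  proof (rule tendstoI)
    fix c :: real assume "c > 0"
    then have "c / 2 > 0" by simp
    from g close[OF this]
    show "\<forall>\<^sub>F e in F. dist (\<integral>x. p x * g e x \<partial>M) (\<integral>x. p x * \<gamma> x \<partial>M) < c"
      by eventually_elim (use key[OF \<open>c / 2 > 0\<close>] \<open>c > 0\<close> in \<open>fastforce simp: dist_real_def\<close>)
  qed
qed


section \<open>Expansion of the divergence\<close>

text \<open>This integral does not involve the coefficient \<open>\<kappa>\<close> of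
  \<open>R\<close>. Both inputs of a merge therefore share it, and in the balance equation it can be
  factored out.\<close>

lemma divergence_quadratic_part:
  fixes Q R :: "real \<Rightarrow> 'a \<Rightarrow> real"
  assumes p: "prob_density M p"
    and QR: "\<forall>\<^sub>F e in at 0. Q e \<in> borel_measurable M \<and> R e \<in> borel_measurable M"
    and \<Delta>: "\<Delta> \<in> borel_measurable M" "AE x in M. \<bar>\<Delta> x\<bar> \<le> K"
    and Q: "((\<lambda>z. Q (fst z) (snd z) / p (snd z)) \<longlongrightarrow> 1) (ae_uniform (at 0) M)"
    and R: "((\<lambda>z. R (fst z) (snd z) / (fst z * p (snd z)) - \<Delta> (snd z)) \<longlongrightarrow> 0) (ae_uniform (at 0) M)"
  shows "\<forall>\<^sub>F e in at 0. integrable M (\<lambda>x. p x * ((R e x / (e * p x))\<^sup>2 / (Q e x / p x)))"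
    and "((\<lambda>e. \<integral>x. p x * ((R e x / (e * p x))\<^sup>2 / (Q e x / p x)) \<partial>M)
      \<longlongrightarrow> (\<integral>x. p x * (\<Delta> x)\<^sup>2 \<partial>M)) (at 0)"
proof -
  let ?F = "ae_uniform (at 0) M :: (real \<times> 'a) filter"
  have pm: "p \<in> borel_measurable M" using p by (simp add: prob_density_def)
  have bd: "\<forall>\<^sub>F z in ?F. \<bar>\<Delta> (snd z)\<bar> \<le> K"
    by (rule eventually_ae_uniform_snd) (rule \<Delta>)
  then have bd2: "\<forall>\<^sub>F z in ?F. \<bar>\<Delta> (snd z) * \<Delta> (snd z)\<bar> \<le> K * K"
    by eventually_elim (unfold abs_mult, intro mult_mono, auto)
  have inv: "((\<lambda>z. 1 / (Q (fst z) (snd z) / p (snd z)) - 1) \<longlongrightarrow> 0) ?F"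
    using tendsto_diff[OF tendsto_divide[OF tendsto_const Q] tendsto_const, of 1 1] by simp
  \<comment> \<open>The product rule is applied twice: to the square, with bound \<open>K\<close>,
    and then to the division by \<open>Q / p\<close>, with bound \<open>K * K\<close> on the square
    and 1 on the limit of the inverse.\<close>
  have lim: "((\<lambda>z. (R (fst z) (snd z) / (fst z * p (snd z)))\<^sup>2 / (Q (fst z) (snd z) / p (snd z))
      - (\<Delta> (snd z))\<^sup>2) \<longlongrightarrow> 0) ?F"
    using tendsto_mult_bounded_diff[OF tendsto_mult_bounded_diff[OF R R bd bd] inv bd2, of 1]
    by (simp add: power2_eq_square)
  have meas: "\<forall>\<^sub>F e in at 0. (\<lambda>x. (R e x / (e * p x))\<^sup>2 / (Q e x / p x)) \<in> borel_measurable M"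
    using QR by eventually_elim (use pm in auto)
  have sq: "(\<lambda>x. (\<Delta> x)\<^sup>2) \<in> borel_measurable M" "AE x in M. \<bar>(\<Delta> x)\<^sup>2\<bar> \<le> K\<^sup>2"
  proof -
    show "AE x in M. \<bar>(\<Delta> x)\<^sup>2\<bar> \<le> K\<^sup>2"
      using \<Delta>(2)
    proof eventually_elim
      case (elim x)
      from power_mono[OF this, of 2] show ?case by simp
    qed
  qed (use \<Delta>(1) in simp)
  show "\<forall>\<^sub>F e in at 0. integrable M (\<lambda>x. p x * ((R e x / (e * p x))\<^sup>2 / (Q e x / p x)))"
    and "((\<lambda>e. \<integral>x. p x * ((R e x / (e * p x))\<^sup>2 / (Q e x / p x)) \<partial>M)
      \<longlongrightarrow> (\<integral>x. p x * (\<Delta> x)\<^sup>2 \<partial>M)) (at 0)"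
    using integral_ae_uniform[OF p meas sq lim] by auto
qed

text \<open>The ratio inside \<open>f\<close> is \<open>1 + v\<close> with \<open>v\<close> tending
  to 0 essentially uniformly. The quadratic Taylor term gives \<open>I\<close> exactly, and the
  cubic remainder, divided by \<open>e ^ 3\<close>, gives \<open>L\<close>. \<open>I\<close> is kept
  as it stands because its convergence comes without a rate, while \<open>L\<close> needs accuracy
  of order \<open>e\<close>.\<close>

lemma divergence_expansion:
  fixes Q R :: "real \<Rightarrow> 'a \<Rightarrow> real"
  assumes p: "prob_density M p" "\<forall>x\<in>space M. 0 < p x" and gen: "generator f"
    and QR: "\<forall>\<^sub>F e in at 0. Q e \<in> borel_measurable M \<and> R e \<in> borel_measurable M \<and>
      (\<forall>x\<in>space M. 0 \<le> Q e x \<and> 0 \<le> Q e x + \<kappa> e * R e x)"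
    and \<Delta>: "\<Delta> \<in> borel_measurable M" "AE x in M. \<bar>\<Delta> x\<bar> \<le> K"
    and Q: "((\<lambda>z. Q (fst z) (snd z) / p (snd z)) \<longlongrightarrow> 1) (ae_uniform (at 0) M)"
    and R: "((\<lambda>z. R (fst z) (snd z) / (fst z * p (snd z)) - \<Delta> (snd z)) \<longlongrightarrow> 0) (ae_uniform (at 0) M)"
    and \<kappa>: "(\<kappa> \<longlongrightarrow> \<kappa>0) (at 0)"
  defines "I \<equiv> \<lambda>e. \<integral>x. p x * ((R e x / (e * p x))\<^sup>2 / (Q e x / p x)) \<partial>M"
  obtains L where "(L \<longlongrightarrow> \<kappa>0 ^ 3 * A3 f * (\<integral>x. p x * \<Delta> x ^ 3 \<partial>M)) (at 0)"
    and "\<forall>\<^sub>F e in at 0. fdiv M f (\<lambda>x. Q e x + \<kappa> e * R e x) (Q e)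
      = e\<^sup>2 * (A2 f * (\<kappa> e)\<^sup>2 * I e + e * L e)"
proof -
  let ?F = "ae_uniform (at 0) M :: (real \<times> 'a) filter"
  have pm: "p \<in> borel_measurable M" using p by (simp add: prob_density_def)
  \<comment> \<open>Filling in the value \<open>A3 f\<close> makes \<open>\<phi>\<close> continuous
    at 0, so that it composes with limits even where \<open>R\<close> vanishes.\<close>
  define \<phi> where "\<phi> v = (if v = 0 then A3 f else (f (1 + v) - A2 f * v\<^sup>2) / v ^ 3)" for v
  have f1: "f 1 = 0" using gen by (simp add: generator_def)
  have f\<phi>: "f (1 + v) = A2 f * v\<^sup>2 + \<phi> v * v ^ 3" for v
    by (auto simp: \<phi>_def f1)
  have "(\<phi> \<longlongrightarrow> A3 f) (at 0)"
    by (rule Lim_transform_eventually[OF generator_taylor[OF gen]])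
      (auto simp: \<phi>_def eventually_at_filter)
  then have cont: "isCont \<phi> 0" by (simp add: isCont_def \<phi>_def)
  define y where "y = (\<lambda>e x. R e x / (e * p x))"
  define u where "u = (\<lambda>e x. Q e x / p x)"
  \<comment> \<open>This is the divergence integrand over \<open>p\<close> after removal of the
    quadratic term, on the scale \<open>e ^ 3\<close>.\<close>
  define g where "g = (\<lambda>e x. (u e x * f ((Q e x + \<kappa> e * R e x) / Q e x) / e\<^sup>2
      - A2 f * (\<kappa> e)\<^sup>2 * ((y e x)\<^sup>2 / u e x)) / e)"
  have bd: "\<forall>\<^sub>F z in ?F. \<bar>\<Delta> (snd z)\<bar> \<le> K"
    by (rule eventually_ae_uniform_snd) (rule \<Delta>)
  then have bd2: "\<forall>\<^sub>F z in ?F. \<bar>\<Delta> (snd z) * \<Delta> (snd z)\<bar> \<le> K * K"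
    by eventually_elim (unfold abs_mult, intro mult_mono, auto)
  then have bd3: "\<forall>\<^sub>F z in ?F. \<bar>\<Delta> (snd z) * \<Delta> (snd z) * \<Delta> (snd z)\<bar> \<le> K * K * K"
    using bd by eventually_elim (unfold abs_mult, intro mult_mono, auto)
  have u: "((\<lambda>z. u (fst z) (snd z)) \<longlongrightarrow> 1) ?F" using Q by (simp add: u_def)
  have y: "((\<lambda>z. y (fst z) (snd z) - \<Delta> (snd z)) \<longlongrightarrow> 0) ?F" using R by (simp add: y_def)
  have k: "((\<lambda>z. \<kappa> (fst z)) \<longlongrightarrow> \<kappa>0) ?F" by (rule tendsto_ae_uniform_fst[OF \<kappa>])
  have e0: "((\<lambda>z. fst z) \<longlongrightarrow> 0) ?F" by (rule tendsto_ae_uniform_fst) simp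
  have ey: "((\<lambda>z. fst z * y (fst z) (snd z)) \<longlongrightarrow> 0) ?F"
    using tendsto_add[OF tendsto_mult_zero[OF e0 y] lim_null_mult_right_bounded[OF e0, of "\<lambda>z. \<Delta> (snd z)" K]] bd
    by (simp add: algebra_simps)
  have v: "((\<lambda>z. \<kappa> (fst z) * (fst z * y (fst z) (snd z)) / u (fst z) (snd z)) \<longlongrightarrow> 0) ?F"
    using tendsto_divide[OF tendsto_mult[OF k ey] u] by simp
  have c: "((\<lambda>z. \<phi> (\<kappa> (fst z) * (fst z * y (fst z) (snd z)) / u (fst z) (snd z)) * \<kappa> (fst z) ^ 3
      / (u (fst z) (snd z))\<^sup>2 - A3 f * \<kappa>0 ^ 3) \<longlongrightarrow> 0) ?F"
    using isCont_tendsto_compose[OF cont v]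
    by (auto intro!: tendsto_eq_intros u k simp: \<phi>_def)
  \<comment> \<open>The cube is built up by repeated use of the two-factor product rule, with bounds
    \<open>K\<close>, \<open>K * K\<close> and \<open>K * K * K\<close>.\<close>
  have main: "((\<lambda>z. (y (fst z) (snd z) * y (fst z) (snd z) * y (fst z) (snd z))
      * (\<phi> (\<kappa> (fst z) * (fst z * y (fst z) (snd z)) / u (fst z) (snd z)) * \<kappa> (fst z) ^ 3
        / (u (fst z) (snd z))\<^sup>2)
      - (\<Delta> (snd z) * \<Delta> (snd z) * \<Delta> (snd z)) * (A3 f * \<kappa>0 ^ 3)) \<longlongrightarrow> 0) ?F"
    by (rule tendsto_mult_bounded_diff[OF tendsto_mult_bounded_diff[OF
        tendsto_mult_bounded_diff[OF y y bd bd] y bd2 bd] c bd3, of "\<bar>A3 f * \<kappa>0 ^ 3\<bar>"]) simp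
  have "\<forall>\<^sub>F z in ?F. fst z \<noteq> 0"
    by (rule eventually_ae_uniform_fst) (simp add: eventually_at_filter)
  moreover have "\<forall>\<^sub>F z in ?F. 0 < p (snd z)"
    by (rule eventually_ae_uniform_snd) (use p in auto)
  moreover have "\<forall>\<^sub>F z in ?F. 0 < u (fst z) (snd z)"
    using order_tendstoD(1)[OF u] by simp
  ultimately have geq: "\<forall>\<^sub>F z in ?F. g (fst z) (snd z)
      = (y (fst z) (snd z) * y (fst z) (snd z) * y (fst z) (snd z))
      * (\<phi> (\<kappa> (fst z) * (fst z * y (fst z) (snd z)) / u (fst z) (snd z)) * \<kappa> (fst z) ^ 3
        / (u (fst z) (snd z))\<^sup>2)"
  proof eventually_elim
    case (elim z)
    obtain e x where z: "z = (e, x)" by force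
    let ?v = "\<kappa> e * (e * y e x) / u e x"
    have nz: "e \<noteq> 0" "p x > 0" "u e x > 0" using elim z by auto
    then have ratio: "(Q e x + \<kappa> e * R e x) / Q e x = 1 + ?v"
      by (auto simp: u_def y_def field_simps)
    have "g e x = (u e x * (A2 f * ?v\<^sup>2 + \<phi> ?v * ?v ^ 3) / e\<^sup>2
      - A2 f * (\<kappa> e)\<^sup>2 * ((y e x)\<^sup>2 / u e x)) / e"
      unfolding g_def ratio f\<phi> ..
    also have "\<dots> = (y e x * y e x * y e x) * (\<phi> ?v * \<kappa> e ^ 3 / (u e x)\<^sup>2)"
      using nz by (simp add: field_simps power2_eq_square power3_eq_cube)
    finally show ?case by (simp add: z)
  qed
  have lim: "((\<lambda>z. g (fst z) (snd z) - A3 f * \<kappa>0 ^ 3 * \<Delta> (snd z) ^ 3) \<longlongrightarrow> 0) ?F"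
    by (rule Lim_transform_eventually[OF main])
      (use geq in eventually_elim, simp add: power3_eq_cube mult_ac)
  have meas: "\<forall>\<^sub>F e in at 0. g e \<in> borel_measurable M"
    using QR
  proof eventually_elim
    case (elim e)
    \<comment> \<open>The argument of \<open>f\<close> is nonnegative on the whole space: where
      \<open>Q\<close> vanishes, the quotient is 0 by convention.\<close>
    have "(\<lambda>x. f ((Q e x + \<kappa> e * R e x) / Q e x)) \<in> borel_measurable M"
      by (rule generator_comp_measurable[OF gen]) (use elim in auto)
    then show ?case unfolding g_def u_def y_def using elim pm by auto
  qed
  have "(\<lambda>x. A3 f * \<kappa>0 ^ 3 * \<Delta> x ^ 3) \<in> borel_measurable M"
    "AE x in M. \<bar>A3 f * \<kappa>0 ^ 3 * \<Delta> x ^ 3\<bar> \<le> \<bar>A3 f * \<kappa>0 ^ 3\<bar> * K ^ 3"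
  proof -
    show "AE x in M. \<bar>A3 f * \<kappa>0 ^ 3 * \<Delta> x ^ 3\<bar> \<le> \<bar>A3 f * \<kappa>0 ^ 3\<bar> * K ^ 3"
      using \<Delta>(2)
    proof eventually_elim
      case (elim x)
      then have "\<bar>\<Delta> x ^ 3\<bar> \<le> K ^ 3"
        using power_mono[of "\<bar>\<Delta> x\<bar>" K 3] by (simp add: power_abs)
      then show ?case
        unfolding abs_mult[of "A3 f * \<kappa>0 ^ 3"] by (intro mult_left_mono) auto
    qed
  qed (use \<Delta>(1) in simp)
  note int = integral_ae_uniform[OF p(1) meas this lim]
  have QR': "\<forall>\<^sub>F e in at 0. Q e \<in> borel_measurable M \<and> R e \<in> borel_measurable M"
    using QR by eventually_elim auto
  note intI = divergence_quadratic_part(1)[OF p(1) QR' \<Delta> Q R]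
  show thesis
  proof (rule that[of "\<lambda>e. \<integral>x. p x * g e x \<partial>M"])
    show "((\<lambda>e. \<integral>x. p x * g e x \<partial>M) \<longlongrightarrow> \<kappa>0 ^ 3 * A3 f * (\<integral>x. p x * \<Delta> x ^ 3 \<partial>M)) (at 0)"
      using int(2) by (simp add: mult.left_commute[of "p _"] mult.commute[of "A3 f"] flip: integral_mult_right_zero)
    have "\<forall>\<^sub>F e::real in at 0. e \<noteq> 0" by (simp add: eventually_at_filter)
    with int(1) intI
    show "\<forall>\<^sub>F e in at 0. fdiv M f (\<lambda>x. Q e x + \<kappa> e * R e x) (Q e)
      = e\<^sup>2 * (A2 f * (\<kappa> e)\<^sup>2 * I e + e * (\<integral>x. p x * g e x \<partial>M))"
    proof eventually_elim
      case (elim e)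
      have "fdiv M f (\<lambda>x. Q e x + \<kappa> e * R e x) (Q e) =
        (\<integral>x. e\<^sup>2 * (A2 f * (\<kappa> e)\<^sup>2 * (p x * ((R e x / (e * p x))\<^sup>2 / (Q e x / p x))) + e * (p x * g e x)) \<partial>M)"
        unfolding fdiv_def
      proof (rule Bochner_Integration.integral_cong)
        fix x assume "x \<in> space M"
        then have px: "p x > 0" using p by auto
        \<comment> \<open>The identity holds whatever the values of \<open>r\<close> and
          \<open>s\<close> are, hence also at points where they involve division by zero.\<close>
        define r where "r = f ((Q e x + \<kappa> e * R e x) / Q e x)"
        define s where "s = (y e x)\<^sup>2 / u e x"
        show "Q e x * f ((Q e x + \<kappa> e * R e x) / Q e x) =
          e\<^sup>2 * (A2 f * (\<kappa> e)\<^sup>2 * (p x * ((R e x / (e * p x))\<^sup>2 / (Q e x / p x))) + e * (p x * g e x))"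
          unfolding g_def y_def[symmetric, THEN fun_cong, THEN fun_cong] u_def[symmetric, THEN fun_cong, THEN fun_cong]
          unfolding r_def[symmetric] s_def[symmetric]
          using px elim(3) by (simp add: u_def field_simps power2_eq_square)
      qed simp
      also have "\<dots> = e\<^sup>2 * (A2 f * (\<kappa> e)\<^sup>2 * I e + e * (\<integral>x. p x * g e x \<partial>M))"
      proof -
        have "(\<integral>x. a * (k * S x + e * T x) \<partial>M) = a * (k * (\<integral>x. S x \<partial>M) + e * (\<integral>x. T x \<partial>M))"
          if "integrable M S" "integrable M T" for a k and S T :: "'a \<Rightarrow> real"
          using that by simp
        from this[OF elim(2,1)] show ?thesis unfolding I_def .
      qed
      finally show ?case .
    qed
  qed
qed


section \<open>Second-order expansions of density families\<close>

text \<open>For a single pair this recasts \<open>density_expansion\<close>: the bound in the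
  weighted norm becomes a limit along \<open>ae_uniform\<close>, to which the limit laws
  apply.\<close>

definition second_order :: "'a measure \<Rightarrow> ('a \<Rightarrow> real) \<Rightarrow> (real \<Rightarrow> 'a \<Rightarrow> real) \<Rightarrow>
    ('a \<Rightarrow> real) \<Rightarrow> ('a \<Rightarrow> real) \<Rightarrow> bool" where
  "second_order M p q H U \<longleftrightarrow>
     (\<forall>\<^sub>F e in at 0. prob_density M (q e)) \<and>
     ((\<lambda>z. (q (fst z) (snd z) - (p (snd z) + fst z * H (snd z) + (fst z)\<^sup>2 * U (snd z)))
         / ((fst z)\<^sup>2 * p (snd z))) \<longlongrightarrow> 0) (ae_uniform (at 0) M)"

lemma pnorm_le_iff:
  assumes "g \<in> borel_measurable M" "p \<in> borel_measurable M"
  shows "pnorm M p g \<le> ereal c \<longleftrightarrow> (AE x in M. \<bar>g x / p x\<bar> \<le> c)"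
proof
  assume "pnorm M p g \<le> ereal c"
  then show "AE x in M. \<bar>g x / p x\<bar> \<le> c"
    using esssup_AE[of "\<lambda>x. ereal \<bar>g x / p x\<bar>" M]
    by (auto simp: pnorm_def elim!: eventually_mono dest: order_trans simp flip: ereal_less_eq(3))
next
  assume "AE x in M. \<bar>g x / p x\<bar> \<le> c"
  then show "pnorm M p g \<le> ereal c"
    unfolding pnorm_def by (intro esssup_I) (use assms in auto)
qed

lemma bounded_coeffs_iff:
  assumes "p \<in> borel_measurable M"
  shows "g \<in> bounded_coeffs M p \<longleftrightarrow> g \<in> borel_measurable M \<and> (\<exists>K. AE x in M. \<bar>g x / p x\<bar> \<le> K)"
proof -
  have "pnorm M p g < \<infinity> \<longleftrightarrow> (\<exists>K. pnorm M p g \<le> ereal K)"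
    by (cases "pnorm M p g") auto
  then show ?thesis
    using pnorm_le_iff[OF _ assms] by (auto simp: bounded_coeffs_def)
qed

text \<open>A bound on \<open>pnorm\<close> is an almost everywhere bound as soon as the remainder
  is measurable. The density clause common to both sides supplies this measurability.\<close>

lemma density_expansion_singleton_iff:
  assumes m: "p \<in> borel_measurable M" "H \<in> borel_measurable M" "U \<in> borel_measurable M"
  shows "density_expansion M p {(H, U)} (\<lambda>_ _. q) \<longleftrightarrow> second_order M p q H U"
proof -
  define r where "r = (\<lambda>e x. q e x - (p x + e * H x + e\<^sup>2 * U x))"
  have iff: "pnorm M p (r e) \<le> ereal (c * e\<^sup>2) \<longleftrightarrow> (AE x in M. \<bar>r e x / (e\<^sup>2 * p x)\<bar> \<le> c)"
    if "prob_density M (q e)" "e \<noteq> 0" for e c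
  proof -
    have "r e \<in> borel_measurable M"
      using that m by (auto simp: r_def prob_density_def)
    moreover have "\<bar>r e x / (e\<^sup>2 * p x)\<bar> \<le> c \<longleftrightarrow> \<bar>r e x / p x\<bar> \<le> c * e\<^sup>2" for x
    proof -
      have eq: "\<bar>r e x / (e\<^sup>2 * p x)\<bar> = \<bar>r e x / p x\<bar> / e\<^sup>2" by (simp add: abs_mult)
      show ?thesis unfolding eq by (rule pos_divide_le_eq) (use that(2) in simp)
    qed
    ultimately show ?thesis by (simp only: pnorm_le_iff[OF _ m(1)])
  qed
  have nz: "\<forall>\<^sub>F e::real in at 0. e \<noteq> 0" by (simp add: eventually_at_filter)
  have "(\<forall>c>0. \<forall>\<^sub>F e in at 0. pnorm M p (r e) \<le> ereal (c * e\<^sup>2)) \<longleftrightarrow>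
    ((\<lambda>z. r (fst z) (snd z) / ((fst z)\<^sup>2 * p (snd z))) \<longlongrightarrow> 0) (ae_uniform (at 0) M)"
    (is "?L \<longleftrightarrow> ?R") if q: "\<forall>\<^sub>F e in at 0. prob_density M (q e)"
  proof
    assume L: ?L
    show ?R
    proof (rule tendstoI)
      fix c :: real assume "c > 0"
      \<comment> \<open>The limit asks for a strict inequality, hence the half.\<close>
      then have "\<forall>\<^sub>F e in at 0. pnorm M p (r e) \<le> ereal (c / 2 * e\<^sup>2)" using L[rule_format, of "c / 2"] \<open>c > 0\<close> by simp
      with q nz show "\<forall>\<^sub>F z in ae_uniform (at 0) M. dist (r (fst z) (snd z) / ((fst z)\<^sup>2 * p (snd z))) 0 < c"
        unfolding eventually_ae_uniform
      proof eventually_elim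
        case (elim e)
        then have "AE x in M. \<bar>r e x / (e\<^sup>2 * p x)\<bar> \<le> c / 2" using iff by blast
        then show ?case by eventually_elim (use \<open>c > 0\<close> in \<open>unfold dist_real_def diff_zero fst_conv snd_conv, linarith\<close>)
      qed
    qed
  next
    assume R: ?R
    show ?L
    proof (intro allI impI)
      fix c :: real assume "c > 0"
      from tendstoD[OF R this] have "\<forall>\<^sub>F e in at 0. AE x in M. \<bar>r e x / (e\<^sup>2 * p x)\<bar> < c"
        by (simp add: eventually_ae_uniform dist_real_def)
      with q nz show "\<forall>\<^sub>F e in at 0. pnorm M p (r e) \<le> ereal (c * e\<^sup>2)"
      proof eventually_elim
        case (elim e)
        then have "AE x in M. \<bar>r e x / (e\<^sup>2 * p x)\<bar> \<le> c" by (auto elim: eventually_mono)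
        then show ?case using iff elim by blast
      qed
    qed
  qed
  then show ?thesis
    by (auto simp: density_expansion_def second_order_def r_def)
qed

text \<open>Each claim multiplies the previous order by \<open>e\<close>: first the scaled remainder
  plus the bounded \<open>U / p\<close>, then the first-order difference plus the bounded
  \<open>H / p\<close>. These are the forms in which the divergence expansion takes its
  inputs.\<close>

lemma second_order_first_order:
  assumes q: "second_order M p q H U" and p: "\<forall>x\<in>space M. 0 < p x"
    and H: "AE x in M. \<bar>H x / p x\<bar> \<le> K" and U: "AE x in M. \<bar>U x / p x\<bar> \<le> K'"
  shows "((\<lambda>z. (q (fst z) (snd z) - p (snd z)) / (fst z * p (snd z)) - H (snd z) / p (snd z)) \<longlongrightarrow> 0)
      (ae_uniform (at 0) M)" (is ?first)
    and "((\<lambda>z. q (fst z) (snd z) / p (snd z)) \<longlongrightarrow> 1) (ae_uniform (at 0) M)" (is ?zeroth)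
proof -
  let ?F = "ae_uniform (at 0) M :: (real \<times> 'a) filter"
  have e0: "((\<lambda>z. fst z) \<longlongrightarrow> 0) ?F" by (rule tendsto_ae_uniform_fst) simp
  have nz: "\<forall>\<^sub>F z in ?F. fst z \<noteq> 0 \<and> p (snd z) > 0"
    by (rule eventually_conj[OF eventually_ae_uniform_fst eventually_ae_uniform_snd])
      (use p in \<open>auto simp: eventually_at_filter\<close>)
  have Hb: "\<forall>\<^sub>F z in ?F. norm (H (snd z) / p (snd z)) \<le> K"
    by (rule eventually_ae_uniform_snd) (use H in simp)
  have Ub: "\<forall>\<^sub>F z in ?F. norm (U (snd z) / p (snd z)) \<le> K'"
    by (rule eventually_ae_uniform_snd) (use U in simp)
  have "((\<lambda>z. fst z * (U (snd z) / p (snd z)) + fst z *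
      ((q (fst z) (snd z) - (p (snd z) + fst z * H (snd z) + (fst z)\<^sup>2 * U (snd z)))
         / ((fst z)\<^sup>2 * p (snd z)))) \<longlongrightarrow> 0) ?F"
    using q by (intro tendsto_add_zero tendsto_mult_zero e0 lim_null_mult_right_bounded[OF e0 Ub])
      (simp add: second_order_def)
  then show first: ?first
    by (rule Lim_transform_eventually)
      (use nz in eventually_elim, simp add: field_simps power2_eq_square)
  have "((\<lambda>z. 1 + (fst z * ((q (fst z) (snd z) - p (snd z)) / (fst z * p (snd z)) - H (snd z) / p (snd z))
      + fst z * (H (snd z) / p (snd z)))) \<longlongrightarrow> 1 + 0) ?F"
    by (intro tendsto_add[OF tendsto_const] tendsto_add_zero tendsto_mult_zero e0 first
        lim_null_mult_right_bounded[OF e0 Hb])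
  then have "((\<lambda>z. 1 + (fst z * ((q (fst z) (snd z) - p (snd z)) / (fst z * p (snd z)) - H (snd z) / p (snd z))
      + fst z * (H (snd z) / p (snd z)))) \<longlongrightarrow> 1) ?F" by simp
  then show ?zeroth
    by (rule Lim_transform_eventually)
      (use nz in eventually_elim, simp add: field_simps power2_eq_square)
qed

lemma prob_density_mixture:
  assumes "prob_density M q" "prob_density M r" "s \<in> {0..1}"
  shows "prob_density M (\<lambda>x. (1 - s) * q x + s * r x)"
  using assms by (auto simp: prob_density_def)

section \<open>Expansion of the balanced weight\<close>

text \<open>Solved for \<open>(t e - \<theta>) / e\<close>, the balance equation gives a quotient
  with the cubic terms in the numerator and a denominator of positive limit, so the quotient rule
  for limits yields \<open>tau\<close>.\<close>

lemma balanced_weight_expansion: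
  assumes p: "prob_density M p" "\<forall>x\<in>space M. 0 < p x" and gen: "generator f"
    and g: "gA > 0" "gB > 0"
    and HA: "HA \<in> bounded_coeffs M p" and UA: "UA \<in> bounded_coeffs M p"
    and HB: "HB \<in> bounded_coeffs M p" and UB: "UB \<in> bounded_coeffs M p"
    and qA: "second_order M p qA HA UA" and qB: "second_order M p qB HB UB"
    and J: "(\<integral>x. ((HB x - HA x) / p x)\<^sup>2 * p x \<partial>M) > 0"
    and sol: "local_solution M f gA gB qA qB (gB / (gA + gB)) t"
  shows "((\<lambda>e. (t e - gB / (gA + gB)) / e)
    \<longlongrightarrow> tau M p f (gA\<^sup>2) (gB\<^sup>2) (\<lambda>x. HA x / p x) (\<lambda>x. HB x / p x)) (at 0)"
proof -
  let ?F = "ae_uniform (at 0) M :: (real \<times> 'a) filter"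
  define \<theta> where "\<theta> = gB / (gA + gB)"
  define \<Delta> where "\<Delta> x = HB x / p x - HA x / p x" for x
  define R where "R e x = qB e x - qA e x" for e x
  define Q where "Q e x = (1 - t e) * qA e x + t e * qB e x" for e x
  have pm: "p \<in> borel_measurable M" using p by (simp add: prob_density_def)
  obtain KA KA' KB KB' where K:
    "AE x in M. \<bar>HA x / p x\<bar> \<le> KA" "AE x in M. \<bar>UA x / p x\<bar> \<le> KA'"
    "AE x in M. \<bar>HB x / p x\<bar> \<le> KB" "AE x in M. \<bar>UB x / p x\<bar> \<le> KB'"
    using HA UA HB UB by (auto simp: bounded_coeffs_iff[OF pm])
  have \<Delta>: "\<Delta> \<in> borel_measurable M" "AE x in M. \<bar>\<Delta> x\<bar> \<le> KA + KB"
  proof -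
    show "\<Delta> \<in> borel_measurable M"
      using HA HB pm by (auto simp: \<Delta>_def[abs_def] bounded_coeffs_def)
    show "AE x in M. \<bar>\<Delta> x\<bar> \<le> KA + KB"
      using K(1) K(3) by eventually_elim (unfold \<Delta>_def, linarith)
  qed
  have t: "(t \<longlongrightarrow> \<theta>) (at 0)"
    and bal: "\<forall>\<^sub>F e in at 0. t e \<in> {0..1} \<and> balanced M f gA gB (qA e) (qB e) (t e)"
    using sol by (auto simp: local_solution_def \<theta>_def elim: eventually_mono)
  note tF = tendsto_ae_uniform_fst[OF t]
  have dens: "\<forall>\<^sub>F e in at 0. prob_density M (qA e) \<and> prob_density M (qB e)"
    using qA qB by (auto simp: second_order_def intro: eventually_conj)
  have Qlim: "((\<lambda>z. Q (fst z) (snd z) / p (snd z)) \<longlongrightarrow> 1) ?F"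
    using tendsto_add[OF tendsto_mult[OF tendsto_diff[OF tendsto_const[of 1] tF]
          second_order_first_order(2)[OF qA p(2) K(1,2)]]
        tendsto_mult[OF tF second_order_first_order(2)[OF qB p(2) K(3,4)]]]
    by (simp add: Q_def add_divide_distrib)
  have Rlim: "((\<lambda>z. R (fst z) (snd z) / (fst z * p (snd z)) - \<Delta> (snd z)) \<longlongrightarrow> 0) ?F"
    using tendsto_diff[OF second_order_first_order(1)[OF qB p(2) K(3,4)]
        second_order_first_order(1)[OF qA p(2) K(1,2)]]
    by (simp add: R_def \<Delta>_def diff_divide_distrib algebra_simps)
  have QA: "Q e x + (- t e) * R e x = qA e x" and QB: "Q e x + (1 - t e) * R e x = qB e x" for e x
    by (simp_all add: Q_def R_def algebra_simps)
  have QR: "\<forall>\<^sub>F e in at 0. Q e \<in> borel_measurable M \<and> R e \<in> borel_measurable M"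
    and QRA: "\<forall>\<^sub>F e in at 0. Q e \<in> borel_measurable M \<and> R e \<in> borel_measurable M \<and>
      (\<forall>x\<in>space M. 0 \<le> Q e x \<and> 0 \<le> Q e x + (- t e) * R e x)"
    and QRB: "\<forall>\<^sub>F e in at 0. Q e \<in> borel_measurable M \<and> R e \<in> borel_measurable M \<and>
      (\<forall>x\<in>space M. 0 \<le> Q e x \<and> 0 \<le> Q e x + (1 - t e) * R e x)"
  proof -
    \<comment> \<open>As \<open>t e\<close> lies in the unit interval, the mixture is a density.
      Nonnegativity of mixture and inputs is what the divergence expansion requires.\<close>
    have *: "\<forall>\<^sub>F e in at 0. prob_density M (Q e) \<and> prob_density M (qA e) \<and> prob_density M (qB e)"
      using dens bal by eventually_elim (auto simp: Q_def[abs_def] intro: prob_density_mixture)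
    then show "\<forall>\<^sub>F e in at 0. Q e \<in> borel_measurable M \<and> R e \<in> borel_measurable M"
      by eventually_elim (auto simp: R_def[abs_def] prob_density_def)
    then show "\<forall>\<^sub>F e in at 0. Q e \<in> borel_measurable M \<and> R e \<in> borel_measurable M \<and>
        (\<forall>x\<in>space M. 0 \<le> Q e x \<and> 0 \<le> Q e x + (- t e) * R e x)"
      and "\<forall>\<^sub>F e in at 0. Q e \<in> borel_measurable M \<and> R e \<in> borel_measurable M \<and>
        (\<forall>x\<in>space M. 0 \<le> Q e x \<and> 0 \<le> Q e x + (1 - t e) * R e x)"
      unfolding QA QB using * by (eventually_elim, simp add: prob_density_def)+
  qed
  define I where "I e = (\<integral>x. p x * ((R e x / (e * p x))\<^sup>2 / (Q e x / p x)) \<partial>M)" for e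
  define J3 where "J3 = (\<integral>x. p x * \<Delta> x ^ 3 \<partial>M)"
  define J2 where "J2 = (\<integral>x. p x * (\<Delta> x)\<^sup>2 \<partial>M)"
  have I: "(I \<longlongrightarrow> J2) (at 0)"
    using divergence_quadratic_part(2)[OF p(1) QR \<Delta> Qlim Rlim] by (simp add: I_def[abs_def] J2_def)
  have J2: "J2 > 0"
    using J by (simp add: J2_def \<Delta>_def mult.commute diff_divide_distrib)
  obtain LA where LA: "(LA \<longlongrightarrow> (- \<theta>) ^ 3 * A3 f * J3) (at 0)"
    and DA: "\<forall>\<^sub>F e in at 0. fdiv M f (qA e) (Q e) = e\<^sup>2 * (A2 f * (- t e)\<^sup>2 * I e + e * LA e)"
    using divergence_expansion[OF p gen QRA \<Delta> Qlim Rlim tendsto_minus[OF t]]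
    unfolding QA J3_def I_def by blast
  obtain LB where LB: "(LB \<longlongrightarrow> (1 - \<theta>) ^ 3 * A3 f * J3) (at 0)"
    and DB: "\<forall>\<^sub>F e in at 0. fdiv M f (qB e) (Q e) = e\<^sup>2 * (A2 f * (1 - t e)\<^sup>2 * I e + e * LB e)"
    using divergence_expansion[OF p gen QRB \<Delta> Qlim Rlim tendsto_diff[OF tendsto_const t]]
    unfolding QB J3_def I_def by blast
  have A2: "A2 f > 0" using gen by (simp add: generator_def A2_def)
  \<comment> \<open>\<open>D\<close> is the cofactor of \<open>t e - \<theta>\<close> in the
    difference of the two quadratic terms.\<close>
  define D where "D e = A2 f * I e * ((gA + gB) * (gA * t e + gB * (1 - t e)))" for e
  have D: "(D \<longlongrightarrow> A2 f * J2 * ((gA + gB) * (gA * \<theta> + gB * (1 - \<theta>)))) (at 0)"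
    unfolding D_def[abs_def] by (intro tendsto_intros I t)
  have \<theta>1: "1 - \<theta> = gA / (gA + gB)" using g by (simp add: \<theta>_def field_simps)
  have \<theta>s: "\<theta> > 0" "1 - \<theta> > 0" unfolding \<theta>1 using g by (auto simp: \<theta>_def)
  have pos: "A2 f * J2 * ((gA + gB) * (gA * \<theta> + gB * (1 - \<theta>))) > 0"
    using A2 J2 g \<theta>s by (intro mult_pos_pos add_pos_pos) auto
  have "\<forall>\<^sub>F e::real in at 0. e \<noteq> 0" by (simp add: eventually_at_filter)
  with DA DB bal order_tendstoD(1)[OF D pos]
  have eq: "\<forall>\<^sub>F e in at 0. (gB\<^sup>2 * LB e - gA\<^sup>2 * LA e) / D e = (t e - \<theta>) / e"
  proof eventually_elim
    case (elim e)
    have "gA\<^sup>2 * fdiv M f (qA e) (Q e) = gB\<^sup>2 * fdiv M f (qB e) (Q e)"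
      using elim(3) unfolding balanced_def Q_def[abs_def] by blast
    then have "gA\<^sup>2 * (A2 f * (t e)\<^sup>2 * I e + e * LA e) = gB\<^sup>2 * (A2 f * (1 - t e)\<^sup>2 * I e + e * LB e)"
      using elim(5) unfolding elim(1,2) by simp
    then have "e * (gB\<^sup>2 * LB e - gA\<^sup>2 * LA e) = A2 f * I e * (gA\<^sup>2 * (t e)\<^sup>2 - gB\<^sup>2 * (1 - t e)\<^sup>2)"
      by (simp add: algebra_simps)
    also have "gA\<^sup>2 * (t e)\<^sup>2 - gB\<^sup>2 * (1 - t e)\<^sup>2 = (gA * t e - gB * (1 - t e)) * (gA * t e + gB * (1 - t e))"
      by (simp add: algebra_simps power2_eq_square)
    also have "gA * t e - gB * (1 - t e) = (t e - \<theta>) * (gA + gB)"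
      using g by (simp add: \<theta>_def field_simps)
    finally have "e * (gB\<^sup>2 * LB e - gA\<^sup>2 * LA e) = (t e - \<theta>) * D e"
      by (simp add: D_def mult_ac)
    then show ?case using elim by (simp add: field_simps)
  qed
  have "((\<lambda>e. (t e - \<theta>) / e) \<longlongrightarrow>
      (gB\<^sup>2 * ((1 - \<theta>) ^ 3 * A3 f * J3) - gA\<^sup>2 * ((- \<theta>) ^ 3 * A3 f * J3))
      / (A2 f * J2 * ((gA + gB) * (gA * \<theta> + gB * (1 - \<theta>))))) (at 0)"
    by (rule Lim_transform_eventually[OF _ eq], intro tendsto_intros LA LB D) (metis pos less_irrefl)
  also have "(gB\<^sup>2 * ((1 - \<theta>) ^ 3 * A3 f * J3) - gA\<^sup>2 * ((- \<theta>) ^ 3 * A3 f * J3))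
      / (A2 f * J2 * ((gA + gB) * (gA * \<theta> + gB * (1 - \<theta>))))
    = A3 f * J3 * (gA\<^sup>2 * \<theta> ^ 3 + gB\<^sup>2 * (1 - \<theta>) ^ 3) / (2 * A2 f * J2 * (gA\<^sup>2 * \<theta> + gB\<^sup>2 * (1 - \<theta>)))"
  proof -
    \<comment> \<open>Both sides equal \<open>2 * gA * gB\<close>, which explains the factor 2 in
      the denominator of \<open>tau\<close>.\<close>
    have den: "(gA + gB) * (gA * \<theta> + gB * (1 - \<theta>)) = 2 * (gA\<^sup>2 * \<theta> + gB\<^sup>2 * (1 - \<theta>))"
      unfolding \<theta>1 using g by (simp add: \<theta>_def divide_simps power2_eq_square) (simp add: algebra_simps)
    have num: "gB\<^sup>2 * ((1 - \<theta>) ^ 3 * A3 f * J3) - gA\<^sup>2 * ((- \<theta>) ^ 3 * A3 f * J3)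
        = A3 f * J3 * (gA\<^sup>2 * \<theta> ^ 3 + gB\<^sup>2 * (1 - \<theta>) ^ 3)"
      by (simp add: algebra_simps)
    show ?thesis unfolding den num by (simp add: mult_ac)
  qed
  also have "\<dots> = tau M p f (gA\<^sup>2) (gB\<^sup>2) (\<lambda>x. HA x / p x) (\<lambda>x. HB x / p x)"
    using g by (simp add: tau_def Let_def J2_def J3_def \<Delta>_def \<theta>_def mult.commute[of "p _"])
  finally show ?thesis by (simp add: \<theta>_def)
qed


section \<open>Merging two expansions\<close>

text \<open>With \<open>t e = \<theta> + e * (\<tau> + o(1))\<close>, the weight correction times
  the first-order difference \<open>HB - HA\<close> moves up to second order and creates the
  \<open>\<tau>\<close> term. The remaining error has three parts: the error of the weight quotient
  times \<open>HB - HA\<close>, \<open>t e - \<theta>\<close> times \<open>UB - UA\<close>, and the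
  mixture of the two old remainders.\<close>

lemma second_order_merge:
  assumes p: "prob_density M p" "\<forall>x\<in>space M. 0 < p x"
    and HA: "HA \<in> bounded_coeffs M p" and UA: "UA \<in> bounded_coeffs M p"
    and HB: "HB \<in> bounded_coeffs M p" and UB: "UB \<in> bounded_coeffs M p"
    and qA: "second_order M p qA HA UA" and qB: "second_order M p qB HB UB"
    and t01: "\<forall>\<^sub>F e in at 0. t e \<in> {0..1}"
    and t: "(t \<longlongrightarrow> \<theta>) (at 0)"
    and t': "((\<lambda>e. (t e - \<theta>) / e) \<longlongrightarrow> \<tau>) (at 0)"
  shows "second_order M p (\<lambda>e x. (1 - t e) * qA e x + t e * qB e x)
    (\<lambda>x. (1 - \<theta>) * HA x + \<theta> * HB x)
    (\<lambda>x. (1 - \<theta>) * UA x + \<theta> * UB x + \<tau> * (HB x - HA x))"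
  unfolding second_order_def
proof
  show "\<forall>\<^sub>F e in at 0. prob_density M (\<lambda>x. (1 - t e) * qA e x + t e * qB e x)"
    using t01 qA[unfolded second_order_def, THEN conjunct1] qB[unfolded second_order_def, THEN conjunct1]
    by eventually_elim (rule prob_density_mixture)
  let ?F = "ae_uniform (at 0) M :: (real \<times> 'a) filter"
  define rem where "rem q H U = (\<lambda>z. (q (fst z) (snd z) - (p (snd z) + fst z * H (snd z) + (fst z)\<^sup>2 * U (snd z)))
         / ((fst z)\<^sup>2 * p (snd z)))" for q :: "real \<Rightarrow> 'a \<Rightarrow> real" and H U
  have pm: "p \<in> borel_measurable M" using p by (simp add: prob_density_def)
  obtain KA KA' KB KB' where K:
    "AE x in M. \<bar>HA x / p x\<bar> \<le> KA" "AE x in M. \<bar>UA x / p x\<bar> \<le> KA'"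
    "AE x in M. \<bar>HB x / p x\<bar> \<le> KB" "AE x in M. \<bar>UB x / p x\<bar> \<le> KB'"
    using HA UA HB UB by (auto simp: bounded_coeffs_iff[OF pm])
  have HK: "\<forall>\<^sub>F z in ?F. norm (HB (snd z) / p (snd z) - HA (snd z) / p (snd z)) \<le> KA + KB"
    by (rule eventually_ae_uniform_snd) (use K(1,3) in eventually_elim, unfold real_norm_def, linarith)
  have UK: "\<forall>\<^sub>F z in ?F. norm (UB (snd z) / p (snd z) - UA (snd z) / p (snd z)) \<le> KA' + KB'"
    by (rule eventually_ae_uniform_snd) (use K(2,4) in eventually_elim, unfold real_norm_def, linarith)
  have rA: "(rem qA HA UA \<longlongrightarrow> 0) ?F" and rB: "(rem qB HB UB \<longlongrightarrow> 0) ?F"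
    using qA qB by (auto simp: second_order_def rem_def)
  have nz: "\<forall>\<^sub>F z in ?F. fst z \<noteq> 0 \<and> p (snd z) > 0"
    by (rule eventually_conj[OF eventually_ae_uniform_fst eventually_ae_uniform_snd])
      (use p in \<open>auto simp: eventually_at_filter\<close>)
  have tF: "((\<lambda>z. t (fst z)) \<longlongrightarrow> \<theta>) ?F"
    by (rule tendsto_ae_uniform_fst[OF t])
  have "((\<lambda>z. (t (fst z) - \<theta>) / fst z - \<tau>) \<longlongrightarrow> 0) ?F"
    using tendsto_diff[OF tendsto_ae_uniform_fst[OF t'] tendsto_const[of \<tau>]] by simp
  from lim_null_mult_right_bounded[OF this HK]
  have 1: "((\<lambda>z. ((t (fst z) - \<theta>) / fst z - \<tau>) * (HB (snd z) / p (snd z) - HA (snd z) / p (snd z))) \<longlongrightarrow> 0) ?F" .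
  have "((\<lambda>z. t (fst z) - \<theta>) \<longlongrightarrow> 0) ?F"
    using tendsto_diff[OF tF tendsto_const[of \<theta>]] by simp
  from lim_null_mult_right_bounded[OF this UK]
  have 2: "((\<lambda>z. (t (fst z) - \<theta>) * (UB (snd z) / p (snd z) - UA (snd z) / p (snd z))) \<longlongrightarrow> 0) ?F" .
  have 3: "((\<lambda>z. (1 - t (fst z)) * rem qA HA UA z + t (fst z) * rem qB HB UB z) \<longlongrightarrow> 0) ?F"
    using tendsto_add[OF tendsto_mult[OF tendsto_diff[OF tendsto_const[of 1] tF] rA] tendsto_mult[OF tF rB]]
    by simp
  from tendsto_add_zero[OF tendsto_add_zero[OF 1 2] 3]
  show "((\<lambda>z. ((1 - t (fst z)) * qA (fst z) (snd z) + t (fst z) * qB (fst z) (snd z)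
      - (p (snd z) + fst z * ((1 - \<theta>) * HA (snd z) + \<theta> * HB (snd z))
        + (fst z)\<^sup>2 * ((1 - \<theta>) * UA (snd z) + \<theta> * UB (snd z) + \<tau> * (HB (snd z) - HA (snd z)))))
      / ((fst z)\<^sup>2 * p (snd z))) \<longlongrightarrow> 0) ?F"
  proof (rule Lim_transform_eventually)
    from nz show "\<forall>\<^sub>F z in ?F. ((t (fst z) - \<theta>) / fst z - \<tau>) * (HB (snd z) / p (snd z) - HA (snd z) / p (snd z))
      + (t (fst z) - \<theta>) * (UB (snd z) / p (snd z) - UA (snd z) / p (snd z))
      + ((1 - t (fst z)) * rem qA HA UA z + t (fst z) * rem qB HB UB z) =
      ((1 - t (fst z)) * qA (fst z) (snd z) + t (fst z) * qB (fst z) (snd z)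
      - (p (snd z) + fst z * ((1 - \<theta>) * HA (snd z) + \<theta> * HB (snd z))
        + (fst z)\<^sup>2 * ((1 - \<theta>) * UA (snd z) + \<theta> * UB (snd z) + \<tau> * (HB (snd z) - HA (snd z)))))
      / ((fst z)\<^sup>2 * p (snd z))"
    proof eventually_elim
      case (elim z)
      then show ?case
        unfolding rem_def
        by (simp add: divide_simps power2_eq_square) (simp add: algebra_simps)
    qed
  qed
qed

section \<open>Trees, blocks and the first-order coefficient\<close>

lemma subtrees_refl: "S \<in> subtrees S"
  by (cases S) auto

lemma subtrees_trans: "S \<in> subtrees T \<Longrightarrow> subtrees S \<subseteq> subtrees T"
  by (induction T) auto

lemma block_subtree: "S \<in> subtrees T \<Longrightarrow> block S \<subseteq> block T"
  by (induction T) auto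

lemma admissible_block:
  assumes "admissible M p f w h b n \<U>" "T \<in> \<U>" "S \<in> subtrees T"
  shows "block S \<subseteq> {1..n}"
proof -
  have "leaves T = [1..<n+1]"
    using assms(1,2) unfolding admissible_def full_trees_def by blast
  then have "block T = {1..n}" by auto
  with block_subtree[OF assms(3)] show ?thesis by simp
qed

lemma leaves_nonempty: "leaves T \<noteq> []"
  by (induction T) auto

text \<open>Both children have leaves, so a merge cuts the list at an interior position into two
  shorter lists. Finiteness of the tree set is what later makes expansions uniform over the
  chart.\<close>

lemma finite_leaves: "finite {T. leaves T = xs}"
proof (induction xs rule: length_induct)
  case (1 xs)
  let ?C = "(\<lambda>k. {T. leaves T = take k xs} \<times> {T. leaves T = drop k xs})"
  have "finite (\<Union>k\<in>{1..<length xs}. ?C k)"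
    using 1 by (intro finite_UN_I finite_SigmaI) auto
  \<comment> \<open>The inclusion may be strict, so the unspecified \<open>hd []\<close> does no
    harm.\<close>
  moreover have "{T. leaves T = xs} \<subseteq> {Lf (hd xs)} \<union> (\<lambda>(l, r). Merge l r) ` (\<Union>k\<in>{1..<length xs}. ?C k)"
  proof
    fix T assume "T \<in> {T. leaves T = xs}"
    then show "T \<in> {Lf (hd xs)} \<union> (\<lambda>(l, r). Merge l r) ` (\<Union>k\<in>{1..<length xs}. ?C k)"
    proof (cases T)
      case (Merge l r)
      moreover from this \<open>T \<in> _\<close> have "xs = leaves l @ leaves r" by simp
      moreover have "length (leaves l) \<in> {1..<length xs}"
        using calculation(2) leaves_nonempty[of l] leaves_nonempty[of r] by (auto simp: Suc_le_eq)
      ultimately show ?thesis by force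
    qed auto
  qed
  ultimately show ?case
    by (auto intro: finite_subset)
qed

lemma G_pos:
  assumes "\<And>i. i \<in> block T \<Longrightarrow> 0 < w i"
  shows "0 < G w T"
  unfolding G_def using assms leaves_nonempty[of T] by (intro sum_pos) auto

lemma G_Merge:
  assumes "block l \<inter> block r = {}"
  shows "G w (Merge l r) = G w l + G w r"
  using assms by (simp add: G_def sum.union_disjoint)

text \<open>On disjoint blocks both \<open>G\<close> and \<open>G\<close> times \<open>coefH\<close>
  are additive. Hence the bracketing leaves no trace in the first-order coefficient.\<close>

lemma coefH_eq_weighted_mean:
  assumes "distinct (leaves T)" "\<And>i. i \<in> block T \<Longrightarrow> 0 < w i"
  shows "coefH w h T = (\<lambda>x. (\<Sum>i\<in>block T. sqrt (w i) * h i x) / G w T)"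
  using assms
proof (induction T)
  case (Merge l r)
  then have "G w l > 0" "G w r > 0" "block l \<inter> block r = {}"
    by (auto intro!: G_pos)
  with Merge show ?case
    by (auto simp: G_Merge sum.union_disjoint)
next
  case (Lf i)
  then show ?case by (simp add: G_def)
qed

section \<open>Bounded and zero-mass coefficients\<close>

lemma bounded_coeffs_integrable:
  assumes p: "prob_density M p" "\<forall>x\<in>space M. 0 < p x" and g: "g \<in> bounded_coeffs M p"
  shows "integrable M g"
proof -
  have pm: "p \<in> borel_measurable M" and pi: "integrable M p"
    using p by (auto simp: prob_density_def)
  obtain K where K: "AE x in M. \<bar>g x / p x\<bar> \<le> K" and gm: "g \<in> borel_measurable M"
    using g by (auto simp: bounded_coeffs_iff[OF pm])
  show ?thesis
  proof (rule Bochner_Integration.integrable_bound)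
    show "integrable M (\<lambda>x. K * p x)" using pi by simp
    show "AE x in M. norm (g x) \<le> norm (K * p x)"
      using K AE_space
    proof eventually_elim
      case (elim x)
      then have "p x > 0" using p by auto
      with elim show ?case by (auto simp: abs_mult pos_divide_le_eq intro: order_trans[OF _ mult_right_mono[OF abs_ge_self]])
    qed
  qed (rule gm)
qed

lemma zero_mass_coeffs_diff:
  assumes p: "prob_density M p" "\<forall>x\<in>space M. 0 < p x"
    and g: "g \<in> zero_mass_coeffs M p" and k: "k \<in> zero_mass_coeffs M p"
  shows "(\<lambda>x. g x - k x) \<in> zero_mass_coeffs M p"
proof -
  have pm: "p \<in> borel_measurable M" using p by (simp add: prob_density_def)
  have b: "g \<in> bounded_coeffs M p" "k \<in> bounded_coeffs M p"
    using g k by (auto simp: zero_mass_coeffs_def)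
  then obtain K L where K: "AE x in M. \<bar>g x / p x\<bar> \<le> K" and L: "AE x in M. \<bar>k x / p x\<bar> \<le> L"
    by (auto simp: bounded_coeffs_iff[OF pm])
  have "AE x in M. \<bar>(g x - k x) / p x\<bar> \<le> K + L"
    using K L by eventually_elim (unfold diff_divide_distrib, linarith)
  then show ?thesis
    using b g k bounded_coeffs_integrable[OF p b(1)] bounded_coeffs_integrable[OF p b(2)]
    by (auto simp: zero_mass_coeffs_def bounded_coeffs_iff[OF pm])
qed

section \<open>Uniformity over a finite chart and the scaled limit inferior\<close>

text \<open>Different trees may have the same coefficients but different densities; the family can be made to
  carry the density of any prescribed tree.\<close>

lemma density_expansion_finite_image:
  assumes "finite \<U>" and c: "\<And>T. T \<in> \<U> \<Longrightarrow> density_expansion M p {c T} (\<lambda>_ _. F T)"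
    and T0: "T0 \<in> \<U>"
  obtains q where "density_expansion M p (c ` \<U>) q" "q (fst (c T0)) (snd (c T0)) = F T0"
proof -
  define s where "s z = (if z = c T0 then T0 else (SOME T. T \<in> \<U> \<and> c T = z))" for z
  have s: "s z \<in> \<U> \<and> c (s z) = z" if "z \<in> c ` \<U>" for z
  proof -
    from that have "\<exists>T. T \<in> \<U> \<and> c T = z" by auto
    from someI_ex[OF this] show ?thesis using T0 by (auto simp: s_def)
  qed
  have single: "density_expansion M p {z} (\<lambda>_ _. F (s z))" if "z \<in> c ` \<U>" for z
    using c[of "s z"] s[OF that] by simp
  have "density_expansion M p (c ` \<U>) (\<lambda>H U. F (s (H, U)))"
    unfolding density_expansion_def
  \<comment> \<open>The chart is finite, so the eventual statements for its single pairs combine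
    into one that is uniform over it.\<close>
  proof (intro conjI allI impI eventually_ball_finite ballI)
    fix z assume "z \<in> c ` \<U>"
    from single[OF this]
    show "\<forall>\<^sub>F \<epsilon> in at 0. case z of (H, U) \<Rightarrow> prob_density M (F (s (H, U)) \<epsilon>)"
      by (cases z) (simp add: density_expansion_def)
  next
    fix z and k :: real assume "z \<in> c ` \<U>" "k > 0"
    with single[OF this(1)]
    show "\<forall>\<^sub>F \<epsilon> in at 0. case z of (H, U) \<Rightarrow>
        pnorm M p (\<lambda>x. F (s (H, U)) \<epsilon> x - (p x + \<epsilon> * H x + \<epsilon>\<^sup>2 * U x)) \<le> ereal (k * \<epsilon>\<^sup>2)"
      by (cases z) (simp add: density_expansion_def)
  qed (use \<open>finite \<U>\<close> in auto)
  moreover have "F (s (fst (c T0), snd (c T0))) = F T0"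
    by (simp add: s_def)
  ultimately show thesis by (rule that)
qed

text \<open>After scaling, the lower bound is the constant \<open>k - c\<close>, and
  \<open>c\<close> is arbitrary.\<close>

lemma le_Liminf_scaled:
  assumes "\<And>c. c > 0 \<Longrightarrow> \<forall>\<^sub>F e in at_right 0. ereal (e\<^sup>2 * k - c * e\<^sup>2) \<le> X e"
  shows "ereal k \<le> Liminf (at_right 0) (\<lambda>e. ereal (inverse (e\<^sup>2)) * X e)"
proof (rule ereal_le_epsilon2)
  fix c :: real assume c: "c > 0"
  have "\<forall>\<^sub>F e::real in at_right 0. e > 0" by (simp add: eventually_at_filter)
  with assms[OF c]
  have "\<forall>\<^sub>F e in at_right 0. ereal (k - c) \<le> ereal (inverse (e\<^sup>2)) * X e"
  proof eventually_elim
    case (elim e)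
    have "ereal (inverse (e\<^sup>2)) * ereal (e\<^sup>2 * k - c * e\<^sup>2) \<le> ereal (inverse (e\<^sup>2)) * X e"
      using elim by (intro ereal_mult_left_mono) auto
    moreover have "inverse (e\<^sup>2) * (e\<^sup>2 * k - c * e\<^sup>2) = k - c"
      using elim by (simp add: field_simps)
    ultimately show ?case by simp
  qed
  then have "ereal (k - c) \<le> Liminf (at_right 0) (\<lambda>e. ereal (inverse (e\<^sup>2)) * X e)"
    by (rule Liminf_bounded)
  then show "ereal k \<le> Liminf (at_right 0) (\<lambda>e. ereal (inverse (e\<^sup>2)) * X e) + ereal c"
    by (cases "Liminf (at_right 0) (\<lambda>e. ereal (inverse (e\<^sup>2)) * X e)") auto
qed

section \<open>Induction along a tree\<close>

text \<open>At a merge, the expansions of the children determine that of the balanced weight, and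
  the weight in turn gives the expansion of the mixture. The induction runs over subtrees of a fixed
  \<open>T\<close> in the tree set, since admissibility and the protocol speak only about their
  nodes.\<close>

lemma node_density_second_order:
  assumes p: "prob_density M p" "\<forall>x\<in>space M. 0 < p x" and gen: "generator f"
    and w: "\<forall>i\<in>{1..n}. 0 < w i"
    and hb: "\<forall>i\<in>{1..n}. h i \<in> zero_mass_coeffs M p \<and> b i \<in> zero_mass_coeffs M p"
    and pe: "\<forall>i\<in>{1..n}. density_expansion M p {(h i, b i)} (\<lambda>_ _. pe i)"
    and adm: "admissible M p f w h b n \<U>"
    and prot: "mass_protocol M f w pe \<U> t"
    and T: "T \<in> \<U>" and S: "S \<in> subtrees T"
  shows "second_order M p (node_density pe t S) (coefH w h S) (coefB M p f w h b S)"
  using S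
proof (induction S)
  case (Lf i)
  have pm: "p \<in> borel_measurable M" using p by (simp add: prob_density_def)
  have "i \<in> {1..n}"
    using admissible_block[OF adm T Lf] by auto
  then show ?case
    using pe hb density_expansion_singleton_iff[OF pm, of "h i" "b i" "pe i"]
    by (auto simp: zero_mass_coeffs_def bounded_coeffs_def)
next
  case (Merge l r)
  have sub: "subtrees (Merge l r) \<subseteq> subtrees T" using Merge.prems by (rule subtrees_trans)
  then have lr: "l \<in> subtrees T" "r \<in> subtrees T"
    using subtrees_refl[of l] subtrees_refl[of r] by auto
  have bdd: "coefH w h R \<in> bounded_coeffs M p" "coefB M p f w h b R \<in> bounded_coeffs M p"
    if "R \<in> subtrees T" for R
    using adm T that by (auto simp: admissible_def)
  have Gpos: "G w R > 0" if "R \<in> subtrees T" for R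
  proof (rule G_pos)
    fix i assume "i \<in> block R"
    then have "i \<in> {1..n}"
      using admissible_block[OF adm T that] by auto
    then show "0 < w i" using w by blast
  qed
  note gl = Gpos[OF lr(1)] and gr = Gpos[OF lr(2)]
  have sol: "local_solution M f (G w l) (G w r) (node_density pe t l) (node_density pe t r)
      (theta w l r) (t (Merge l r))"
    using prot T Merge.prems by (auto simp: mass_protocol_def)
  have J: "(\<integral>x. ((coefH w h r x - coefH w h l x) / p x)\<^sup>2 * p x \<partial>M) > 0"
    using adm T Merge.prems by (auto simp: admissible_def mergeJ_def)
  note ex = Merge.IH(1)[OF lr(1)] Merge.IH(2)[OF lr(2)]
  have "(t (Merge l r) \<longlongrightarrow> theta w l r) (at 0)" "\<forall>\<^sub>F e in at 0. t (Merge l r) e \<in> {0..1}"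
    using sol by (auto simp: local_solution_def elim: eventually_mono)
  from second_order_merge[OF p bdd[OF lr(1)] bdd[OF lr(2)] ex this(2,1)
      balanced_weight_expansion[OF p gen gl gr bdd[OF lr(1)] bdd[OF lr(2)] ex J sol[unfolded theta_def],
        folded theta_def]]
  have "second_order M p (node_density pe t (Merge l r))
    (\<lambda>x. (1 - theta w l r) * coefH w h l x + theta w l r * coefH w h r x)
    (coefB M p f w h b (Merge l r))"
    by (simp add: theta_def)
  moreover have "(\<lambda>x. (1 - theta w l r) * coefH w h l x + theta w l r * coefH w h r x) = coefH w h (Merge l r)"
  proof -
    have "1 - theta w l r = G w l / (G w l + G w r)"
      using gl gr by (simp add: theta_def field_simps)
    then show ?thesis by (simp add: theta_def add_divide_distrib)
  qed
  ultimately show ?case by simp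
qed

text \<open>Each merge is linear in the coefficients of its children, and admissibility makes these
  integrable. The two integrals are treated together because the step for \<open>coefB\<close>
  involves \<open>coefH\<close>.\<close>

lemma integral_coefH_coefB:
  assumes p: "prob_density M p" "\<forall>x\<in>space M. 0 < p x"
    and hb: "\<forall>i\<in>{1..n}. h i \<in> zero_mass_coeffs M p \<and> b i \<in> zero_mass_coeffs M p"
    and adm: "admissible M p f w h b n \<U>"
    and T: "T \<in> \<U>" and S: "S \<in> subtrees T"
  shows "(\<integral>x. coefH w h S x \<partial>M) = 0 \<and> (\<integral>x. coefB M p f w h b S x \<partial>M) = 0"
  using S
proof (induction S)
  case (Lf i)
  have "i \<in> {1..n}"
    using admissible_block[OF adm T Lf] by auto
  then show ?case using hb by (auto simp: zero_mass_coeffs_def)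
next
  case (Merge l r)
  have sub: "subtrees (Merge l r) \<subseteq> subtrees T" using Merge.prems by (rule subtrees_trans)
  then have lr: "l \<in> subtrees T" "r \<in> subtrees T"
    using subtrees_refl[of l] subtrees_refl[of r] by auto
  have "integrable M (coefH w h R)" "integrable M (coefB M p f w h b R)" if "R \<in> subtrees T" for R
    using adm T that by (auto simp: admissible_def intro!: bounded_coeffs_integrable[OF p])
  note this[OF lr(1)] this[OF lr(2)]
  then show ?case using Merge.IH(1)[OF lr(1)] Merge.IH(2)[OF lr(2)] by simp
qed

section \<open>Lower bound from a rotation edge\<close>

theorem theorem14:
  fixes M :: "'a measure"
    and p :: "'a \<Rightarrow> real"
    and f :: "real \<Rightarrow> real"
    and n :: nat
    and w :: "nat \<Rightarrow> real"
    and h b :: "nat \<Rightarrow> 'a \<Rightarrow> real"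
    and pe :: "nat \<Rightarrow> real \<Rightarrow> 'a \<Rightarrow> real"
    and \<U> :: "btree set"
    and t :: "btree \<Rightarrow> real \<Rightarrow> real"
    and d :: "('a \<Rightarrow> real) \<Rightarrow> ('a \<Rightarrow> real) \<Rightarrow> real"
    and N :: "('a \<Rightarrow> real) \<Rightarrow> real"
    and T T' :: btree
  assumes "prob_density M p" and "\<forall>x\<in>space M. 0 < p x"
    and "generator f"
    and "2 \<le> n"
    and "\<forall>i\<in>{1..n}. 0 < w i"
    and "\<forall>i\<in>{1..n}. h i \<in> zero_mass_coeffs M p \<and> b i \<in> zero_mass_coeffs M p"
    and "\<forall>i\<in>{1..n}. density_expansion M p {(h i, b i)} (\<lambda>_ _. pe i)"
    and "admissible M p f w h b n \<U>"
    and "mass_protocol M f w pe \<U> t"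
    and "density_metric M d"
    and "coeff_norm M p N"
    and "local_metric_expansion M p d N (generated_chart M p f w h b \<U>)"
    and "T \<in> \<U>" and "T' \<in> \<U>" and "elem_rotation T T'"
  shows "let K = rotation_defect M p f w h b T T';
             L = Liminf (at_right 0) (\<lambda>\<epsilon>. ereal (inverse (\<epsilon>^2)) * AOD d pe t \<U> \<epsilon>)
         in (\<not> (AE x in M. K x = 0) \<longrightarrow> ereal (N K) \<le> L) \<and>
            (\<forall>A B C. T = Merge (Merge A B) C \<and> T' = Merge A (Merge B C) \<longrightarrow>
               K = (\<lambda>x. - curvature M p f w h b A B C x) \<and>
               N K = N (curvature M p f w h b A B C) \<and>
               (\<not> (AE x in M. K x = 0) \<longrightarrow> ereal (N (curvature M p f w h b A B C)) \<le> L)) \<and>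
            (\<forall>A B C. T = Merge A (Merge B C) \<and> T' = Merge (Merge A B) C \<longrightarrow>
               K = curvature M p f w h b A B C \<and>
               N K = N (curvature M p f w h b A B C) \<and>
               (\<not> (AE x in M. K x = 0) \<longrightarrow> ereal (N (curvature M p f w h b A B C)) \<le> L))"
proof -
  note p = assms(1,2) and adm = assms(8)
  define \<C> where "\<C> = generated_chart M p f w h b \<U>"
  define chart where "chart S = (coefH w h S, coefB M p f w h b S)" for S
  define K where "K = rotation_defect M p f w h b T T'"
  define L where "L = Liminf (at_right 0) (\<lambda>\<epsilon>. ereal (inverse (\<epsilon>^2)) * AOD d pe t \<U> \<epsilon>)"
  have \<C>: "\<C> = chart ` \<U>" by (simp add: \<C>_def generated_chart_def chart_def[abs_def])
  have sub: "\<U> \<subseteq> {T. leaves T = [1..<n+1]}"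
    using adm by (auto simp: admissible_def full_trees_def)
  have fin: "finite \<U>" using finite_subset[OF sub finite_leaves] .
  have pm: "p \<in> borel_measurable M" using p by (simp add: prob_density_def)
  have zm: "coefB M p f w h b S \<in> zero_mass_coeffs M p" if "S \<in> \<U>" for S
    using integral_coefH_coefB[OF p assms(6) adm that subtrees_refl] adm that subtrees_refl[of S]
    by (auto simp: zero_mass_coeffs_def admissible_def)
  have dens: "density_expansion M p {chart S} (\<lambda>_ _. node_density pe t S)" if "S \<in> \<U>" for S
  proof -
    have "coefH w h S \<in> borel_measurable M" "coefB M p f w h b S \<in> borel_measurable M"
      using adm that subtrees_refl[of S] by (auto simp: admissible_def bounded_coeffs_def)
    then show ?thesis
      using node_density_second_order[OF p assms(3,5-9) that subtrees_refl]
      by (simp add: chart_def density_expansion_singleton_iff[OF pm])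
  qed
  \<comment> \<open>One family carries the density of \<open>T'\<close> and another that of
    \<open>T\<close>, matching the two arguments of \<open>d\<close> in the metric
    expansion.\<close>
  obtain q where q: "density_expansion M p \<C> q"
    "q (coefH w h T') (coefB M p f w h b T') = node_density pe t T'"
    using density_expansion_finite_image[where c = chart and F = "node_density pe t", OF fin dens assms(14)]
    unfolding \<C> by (auto simp: chart_def)
  obtain r where r: "density_expansion M p \<C> r"
    "r (coefH w h T) (coefB M p f w h b T) = node_density pe t T"
    using density_expansion_finite_image[where c = chart and F = "node_density pe t", OF fin dens assms(13)]
    unfolding \<C> by (auto simp: chart_def)
  \<comment> \<open>The metric expansion compares only pairs with a common first-order coefficient.
    Here it is common because both trees have the same leaves.\<close>
  have H: "coefH w h T' = coefH w h T"
  proof -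
    have lv: "leaves T = [1..<n+1]" "leaves T' = [1..<n+1]" using sub assms(13,14) by auto
    then have "coefH w h S = (\<lambda>x. (\<Sum>i\<in>block S. sqrt (w i) * h i x) / G w S)" if "S \<in> {T, T'}" for S
      using that assms(5) by (intro coefH_eq_weighted_mean) auto
    then show ?thesis using lv by (simp add: G_def)
  qed
  have inC: "(coefH w h T', coefB M p f w h b T') \<in> \<C>" "(coefH w h T', coefB M p f w h b T) \<in> \<C>"
    using imageI[OF assms(14), of chart] imageI[OF assms(13), of chart] H by (simp_all add: \<C> chart_def)
  have bound: "ereal (N K) \<le> L"
    unfolding L_def
  proof (rule le_Liminf_scaled)
    fix c :: real assume "c > 0"
    with assms(12) q(1) r(1) inC
    have "\<forall>\<^sub>F \<epsilon> in at 0. \<bar>d (q (coefH w h T') (coefB M p f w h b T') \<epsilon>) (r (coefH w h T') (coefB M p f w h b T) \<epsilon>)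
        - \<epsilon>\<^sup>2 * N K\<bar> \<le> c * \<epsilon>\<^sup>2"
      unfolding local_metric_expansion_def \<C>_def[symmetric] K_def rotation_defect_def
      by (blast intro: eventually_mono)
    then have "\<forall>\<^sub>F \<epsilon> in at 0. ereal (\<epsilon>\<^sup>2 * N K - c * \<epsilon>\<^sup>2) \<le> AOD d pe t \<U> \<epsilon>"
    proof eventually_elim
      case (elim \<epsilon>)
      have "ereal (\<epsilon>\<^sup>2 * N K - c * \<epsilon>\<^sup>2) \<le> ereal (d (node_density pe t T' \<epsilon>) (node_density pe t T \<epsilon>))"
        using elim q(2) r(2) H by simp
      also have "\<dots> \<le> AOD d pe t \<U> \<epsilon>"
        unfolding AOD_def using assms(13,14) by (blast intro: SUP_upper2)
      finally show ?case .
    qed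
    then show "\<forall>\<^sub>F \<epsilon> in at_right 0. ereal (\<epsilon>\<^sup>2 * N K - c * \<epsilon>\<^sup>2) \<le> AOD d pe t \<U> \<epsilon>"
      by (rule filter_leD[OF at_le, rotated]) simp
  qed
  \<comment> \<open>A rotation to the right produces the negative of the curvature. Homogeneity of
    \<open>N\<close> is available on zero-mass coefficients, so the curvature is shown below to be
    one.\<close>
  have neg: "N (\<lambda>x. - g x) = N g" if "g \<in> zero_mass_coeffs M p" for g
  proof -
    from that assms(11) have "N (\<lambda>x. (-1) * g x) = \<bar>-1\<bar> * N g"
      unfolding coeff_norm_def by blast
    then show ?thesis by simp
  qed
  have "K = (\<lambda>x. - curvature M p f w h b A B C x) \<and> N K = N (curvature M p f w h b A B C)"
    if "T = Merge (Merge A B) C" "T' = Merge A (Merge B C)" for A B C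
  proof -
    have "curvature M p f w h b A B C \<in> zero_mass_coeffs M p"
      using zero_mass_coeffs_diff[OF p zm[OF assms(13)] zm[OF assms(14)]] that
      by (simp add: curvature_def)
    from neg[OF this] show ?thesis
      using that by (simp add: K_def rotation_defect_def curvature_def)
  qed
  moreover have "K = curvature M p f w h b A B C"
    if "T = Merge A (Merge B C)" "T' = Merge (Merge A B) C" for A B C
    using that by (simp add: K_def rotation_defect_def curvature_def)
  ultimately show ?thesis
    using bound unfolding Let_def K_def[symmetric] L_def[symmetric] by metis
qed

end
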